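(* Let $T^n=\{[z_0:\cdots:z_n]\in\mathbb{CP}^n : |z_0|=|z_1|=\cdots=|z_n|\}$ be the Clifford torus, and for $i=0,1,\dots,n$ let $H_i=\{z_i=0\}\subset\mathbb{CP}^n$. For every holomorphic disc $w:(D^2,\partial D^2)\to(\mathbb{CP}^n,T^n)$, the Maslov index $\mu(w)$ equals twice the sum, over $i=0,1,\dots,n$, of the intersection multiplicities of the disc $w$ with the hyperplane $H_i$.
   Context: $D^2\subset\mathbb{C}$ is the closed unit disc; $\mathbb{CP}^n$ carries its standard complex structure and Fubini-Study symplectic form, for which $T^n$ is Lagrangian. A holomorphic disc is a smooth map $w:D^2\to\mathbb{CP}^n$, holomorphic in the interior, with $w(\partial D^2)\subset T^n$. Intersection multiplicity: $w$ can be written in homogeneous coordinates as $[\gamma_0(z):\cdots:\gamma_n(z)]$ with $\gamma_i:D^2\to\mathbb{C}$ holomorphic without common zeros; the intersection multiplicity of $w$ with $H_i$ at $p\in D^2$ is the order of vanishing of $\gamma_i$ at $p$, and the total multiplicity with $H_i$ is the sum over all zeros $p$ of $\gamma_i$. Maslov index: trivialize $w^*T\mathbb{CP}^n\cong D^2\times\mathbb{C}^n$ as a symplectic (Hermitian) vector bundle; then $(w|_{\partial D^2})^*T(T^n)$ defines a loop of Lagrangian subspaces $A(\theta)\cdot\mathbb{R}^n\subset\mathbb{C}^n$, $A(\theta)\in U(n)$, and $\mu(w)$ is the degree of the map $S^1\to U(1)$, $\theta\mapsto\det(A(\theta)A(\theta)^t)$. *)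

theory Defs
  imports "HOL-Complex_Analysis.Complex_Analysis"
begin

section \<open>Complex projective space\<close>

text \<open>
  The type \<open>'n\<close> stands for \<open>{1, ..., n}\<close> and \<open>'n option\<close> for \<open>{0, 1, ..., n}\<close>, so that
  \<open>'n cproj\<close> is \<open>CP^n\<close> with \<open>n = CARD('n) \<ge> 1\<close>.
\<close>

definition hom_equiv :: "complex ^ 'm \<Rightarrow> complex ^ 'm \<Rightarrow> bool" where
  "hom_equiv x y \<longleftrightarrow> x \<noteq> 0 \<and> y \<noteq> 0 \<and> (\<exists>c. c \<noteq> 0 \<and> y = c *s x)"

lemma part_equivp_hom_equiv: "part_equivp (hom_equiv :: complex ^ 'm \<Rightarrow> complex ^ 'm \<Rightarrow> bool)"
proof (rule part_equivpI)
  show "\<exists>x::complex ^ 'm. hom_equiv x x"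
    by (intro exI[of _ "\<chi> i. 1"]) (auto simp: hom_equiv_def vec_eq_iff intro!: exI[of _ 1])
  show "symp (hom_equiv :: complex ^ 'm \<Rightarrow> complex ^ 'm \<Rightarrow> bool)"
  proof (rule sympI)
    fix x y :: "complex ^ 'm" assume "hom_equiv x y"
    then obtain c where "x \<noteq> 0" "y \<noteq> 0" "c \<noteq> 0" "y = c *s x"
      by (auto simp: hom_equiv_def)
    then show "hom_equiv y x"
      unfolding hom_equiv_def by (auto simp: vector_smult_assoc intro!: exI[of _ "inverse c"])
  qed
  show "transp (hom_equiv :: complex ^ 'm \<Rightarrow> complex ^ 'm \<Rightarrow> bool)"
  proof (rule transpI)
    fix x y z :: "complex ^ 'm" assume "hom_equiv x y" "hom_equiv y z"
    then obtain c d where "x \<noteq> 0" "z \<noteq> 0" "c \<noteq> 0" "y = c *s x" "d \<noteq> 0" "z = d *s y"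
      by (auto simp: hom_equiv_def)
    then show "hom_equiv x z"
      unfolding hom_equiv_def by (auto simp: vector_smult_assoc intro!: exI[of _ "d * c"])
  qed
qed

text \<open>For \<open>z \<noteq> 0\<close>, \<open>hpoint z\<close> is the point with homogeneous coordinates \<open>z\<close>.\<close>

quotient_type 'n cproj = "complex ^ ('n::finite option)" / partial: hom_equiv
  morphisms hcoords hpoint
  by (rule part_equivp_hom_equiv)

definition hyperplane :: "'n option \<Rightarrow> 'n::finite cproj set" where
  "hyperplane i = {hpoint z | z. z \<noteq> 0 \<and> z $ i = 0}"

definition clifford_torus :: "'n::finite cproj set" where
  "clifford_torus = {hpoint z | z. z \<noteq> 0 \<and> (\<forall>i j. norm (z $ i) = norm (z $ j))}"

text \<open>
  On the complement of \<open>hyperplane i\<close>, the usual affine chart; its \<open>i\<close>-th component is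
  constantly 1 instead of being omitted.
\<close>

lift_definition affine_chart :: "'n option \<Rightarrow> 'n::finite cproj \<Rightarrow> complex ^ ('n option)"
  is "\<lambda>i z. \<chi> j. z $ j / z $ i"
  by (auto simp: hom_equiv_def vec_eq_iff)

section \<open>Holomorphic discs\<close>

text \<open>\<open>Ck_on k S f\<close>: \<open>f\<close> is of class \<open>C^k\<close>; only used for open subsets \<open>S\<close> of \<open>\<complex>\<close>.\<close>

primrec Ck_on ::
    "nat \<Rightarrow> 'a::real_normed_vector set \<Rightarrow> ('a \<Rightarrow> 'b::real_normed_vector) \<Rightarrow> bool" where
  "Ck_on 0 S f \<longleftrightarrow> continuous_on S f"
| "Ck_on (Suc k) S f \<longleftrightarrow>
     (\<forall>x\<in>S. f differentiable (at x)) \<and> (\<forall>v. Ck_on k S (\<lambda>x. frechet_derivative f (at x) v))"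

definition smooth_on :: "'a::real_normed_vector set \<Rightarrow> ('a \<Rightarrow> 'b::real_normed_vector) \<Rightarrow> bool" where
  "smooth_on S f \<longleftrightarrow> (\<forall>k. Ck_on k S f)"

text \<open>
  Smoothness on the closed disc is, as usual for manifolds with boundary, the local existence of
  smooth extensions in charts. Discs are total functions on \<open>\<complex>\<close>, whose values outside of
  \<open>cball 0 1\<close> play no role.
\<close>

definition smooth_disc :: "(complex \<Rightarrow> 'n::finite cproj) \<Rightarrow> bool" where
  "smooth_disc w \<longleftrightarrow> (\<forall>z0\<in>cball 0 1. \<exists>i V u. open V \<and> z0 \<in> V \<and> smooth_on V u \<and>
     (\<forall>z\<in>V \<inter> cball 0 1. w z \<notin> hyperplane i \<and> affine_chart i (w z) = u z))"

definition holomorphic_into_cproj_on :: "(complex \<Rightarrow> 'n::finite cproj) \<Rightarrow> complex set \<Rightarrow> bool" where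
  "holomorphic_into_cproj_on w U \<longleftrightarrow> (\<forall>z0\<in>U. \<exists>i V. open V \<and> z0 \<in> V \<and> V \<subseteq> U \<and>
     (\<forall>z\<in>V. w z \<notin> hyperplane i) \<and> (\<forall>j. (\<lambda>z. affine_chart i (w z) $ j) holomorphic_on V))"

definition holomorphic_disc :: "'n::finite cproj set \<Rightarrow> (complex \<Rightarrow> 'n cproj) \<Rightarrow> bool" where
  "holomorphic_disc L w \<longleftrightarrow>
     smooth_disc w \<and> holomorphic_into_cproj_on w (ball 0 1) \<and> (\<forall>z\<in>sphere 0 1. w z \<in> L)"

section \<open>Intersection multiplicities\<close>

definition homogeneous_lift ::
    "(complex \<Rightarrow> 'n::finite cproj) \<Rightarrow> (complex \<Rightarrow> complex ^ ('n option)) \<Rightarrow> bool" where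
  "homogeneous_lift w \<gamma> \<longleftrightarrow>
     (\<forall>i. continuous_on (cball 0 1) (\<lambda>z. \<gamma> z $ i) \<and> (\<lambda>z. \<gamma> z $ i) holomorphic_on ball 0 1) \<and>
     (\<forall>z\<in>cball 0 1. \<gamma> z \<noteq> 0 \<and> w z = hpoint (\<gamma> z))"

definition vanishing_order :: "(complex \<Rightarrow> complex) \<Rightarrow> complex \<Rightarrow> nat" where
  "vanishing_order f p = (if f p = 0 then nat (zorder f p) else 0)"

text \<open>
  The multiplicity does not depend on the lift, since two lifts differ by a nowhere vanishing
  factor. A disc with boundary on the Clifford torus meets the hyperplanes only in interior
  points, and no component of a lift of it vanishes identically.
\<close>

definition intersection_multiplicity ::
    "(complex \<Rightarrow> 'n::finite cproj) \<Rightarrow> 'n option \<Rightarrow> complex \<Rightarrow> nat" where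
  "intersection_multiplicity w i p =
     (THE m. \<exists>\<gamma>. homogeneous_lift w \<gamma> \<and> m = vanishing_order (\<lambda>z. \<gamma> z $ i) p)"

definition total_multiplicity :: "(complex \<Rightarrow> 'n::finite cproj) \<Rightarrow> 'n option \<Rightarrow> nat" where
  "total_multiplicity w i =
     (\<Sum>p\<in>{p\<in>cball 0 1. w p \<in> hyperplane i}. intersection_multiplicity w i p)"

section \<open>The tangent bundle with the Fubini-Study metric\<close>

definition cinner :: "complex ^ 'm \<Rightarrow> complex ^ 'm \<Rightarrow> complex" where
  "cinner x y = (\<Sum>i\<in>UNIV. x $ i * cnj (y $ i))"

text \<open>
  The tangent space at a line \<open>\<ell>\<close> is \<open>Hom(\<ell>, \<complex>\<^sup>n\<^sup>+\<^sup>1/\<ell>) = Hom(\<ell>, \<ell>\<^sup>\<bottom>)\<close>, realized as the complex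
  space of those matrices which vanish on \<open>\<ell>\<^sup>\<bottom>\<close> and have range in \<open>\<ell>\<^sup>\<bottom>\<close>. The velocity of a curve
  \<open>hpoint \<circ> \<gamma>\<close> is the homomorphism which maps \<open>\<gamma> t\<close> to the class of \<open>\<gamma>' t\<close>. The tangent bundle thus
  is a subbundle of the trivial bundle of matrices, and it carries the subspace topology.
\<close>

lift_definition tangent_space ::
    "'n::finite cproj \<Rightarrow> (complex ^ ('n option) ^ ('n option)) set"
  is "\<lambda>z. {X. (\<forall>v. cinner (X *v v) z = 0) \<and> (\<forall>v. cinner v z = 0 \<longrightarrow> X *v v = 0)}"
proof -
  fix x y :: "complex ^ ('n option)"
  assume "hom_equiv x y"
  then obtain c where c: "c \<noteq> 0" "y = c *s x"
    by (auto simp: hom_equiv_def)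
  have "cinner v y = cnj c * cinner v x" for v
    by (simp add: c(2) cinner_def sum_distrib_left algebra_simps)
  with c(1) show "{X. (\<forall>v. cinner (X *v v) x = 0) \<and> (\<forall>v. cinner v x = 0 \<longrightarrow> X *v v = 0)} =
      {X. (\<forall>v. cinner (X *v v) y = 0) \<and> (\<forall>v. cinner v y = 0 \<longrightarrow> X *v v = 0)}"
    by simp
qed

text \<open>
  The Hermitian metric \<open>tr(X Y\<^sup>*)\<close>, that is \<open>\<langle>X z, Y z\<rangle> / |z|\<^sup>2\<close> for any \<open>z \<noteq> 0\<close> on the line; its real
  part is the quotient of the round metric on the unit sphere, and its imaginary part is up to
  sign the Fubini-Study form.
\<close>

definition fubini_study :: "complex ^ 'm ^ 'm \<Rightarrow> complex ^ 'm ^ 'm \<Rightarrow> complex" where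
  "fubini_study X Y = (\<Sum>i\<in>UNIV. cinner (X $ i) (Y $ i))"

text \<open>Tangent vectors to a submanifold \<open>L\<close> are the velocities at time 0 of curves in \<open>L\<close>.\<close>

definition tangent_space_of ::
    "'n::finite cproj set \<Rightarrow> 'n cproj \<Rightarrow> (complex ^ ('n option) ^ ('n option)) set" where
  "tangent_space_of L p = {X \<in> tangent_space p.
     \<exists>\<gamma> :: real \<Rightarrow> complex ^ ('n option). \<gamma> C1_differentiable_on UNIV \<and>
       (\<forall>t. \<gamma> t \<noteq> 0 \<and> hpoint (\<gamma> t) \<in> L) \<and> hpoint (\<gamma> 0) = p \<and>
       (\<exists>c. vector_derivative \<gamma> (at 0) = X *v \<gamma> 0 + c *s \<gamma> 0)}"

section \<open>The Maslov index\<close>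

definition hermitian_trivialization ::
    "(complex \<Rightarrow> 'n::finite cproj) \<Rightarrow>
     (complex \<Rightarrow> complex ^ ('n option) ^ ('n option) \<Rightarrow> complex ^ 'n) \<Rightarrow> bool" where
  "hermitian_trivialization w \<Phi> \<longleftrightarrow>
     continuous_on (SIGMA z:cball 0 1. tangent_space (w z)) (\<lambda>(z, X). \<Phi> z X) \<and>
     (\<forall>z\<in>cball 0 1.
        bij_betw (\<Phi> z) (tangent_space (w z)) UNIV \<and>
        (\<forall>X\<in>tangent_space (w z). \<forall>Y\<in>tangent_space (w z).
           \<Phi> z (X + Y) = \<Phi> z X + \<Phi> z Y \<and>
           (\<forall>c. \<Phi> z (\<chi> i. c *s X $ i) = c *s \<Phi> z X) \<and>
           cinner (\<Phi> z X) (\<Phi> z Y) = fubini_study X Y))"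

definition unitary_matrix :: "complex ^ 'n ^ 'n \<Rightarrow> bool" where
  "unitary_matrix A \<longleftrightarrow> A ** (\<chi> i j. cnj (A $ j $ i)) = mat 1"

definition real_vectors :: "(complex ^ 'n) set" where
  "real_vectors = {v. \<forall>i. v $ i \<in> \<real>}"

text \<open>
  The degree of a map \<open>S\<^sup>1 \<rightarrow> U(1)\<close> is rendered as the winding number about 0 of the corresponding
  loop. No continuity of \<open>A\<close> is required: the matrix \<open>A A\<^sup>t\<close> depends only on the Lagrangian
  subspace \<open>A \<real>\<^sup>n\<close>, whereas \<open>A\<close> itself can be chosen as a continuous loop only if the loop of
  Lagrangian subspaces is orientable.
\<close>

definition maslov_index :: "'n::finite cproj set \<Rightarrow> (complex \<Rightarrow> 'n cproj) \<Rightarrow> int" where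
  "maslov_index L w = (THE \<mu>. \<exists>\<Phi> A.
     hermitian_trivialization w \<Phi> \<and>
     (\<forall>z\<in>sphere 0 1. unitary_matrix (A z) \<and>
        \<Phi> z ` tangent_space_of L (w z) = (\<lambda>v. A z *v v) ` real_vectors) \<and>
     winding_number ((\<lambda>z. det (A z ** transpose (A z))) \<circ> circlepath 0 1) 0 = of_int \<mu>)"

end

theory Submission
  imports Defs
begin

text \<open>
  A disc \<open>w\<close> with boundary on the torus has a homogeneous lift \<open>\<gamma>\<close> without common zeros; let \<open>u = \<gamma> / |\<gamma>|\<close>. A
  continuous unitary frame of \<open>u\<^sup>\<bottom>\<close> over the disc trivializes \<open>w\<^sup>*T\<complex>P\<^sup>n\<close>, and on the boundary the
  tangent space of the torus consists of the vectors \<open>(\<i> s\<^sub>j u\<^sub>j)\<^sub>j\<close> with \<open>s\<close> real and \<open>\<Sum> s\<^sub>j = 0\<close>.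
  Hence, in any trivialization, \<open>det (A A\<^sup>t)\<close> is the product of \<open>\<Prod>\<^sub>j u\<^sub>j\<^sup>2\<close> and of a function which extends
  to the disc without zeros, so its degree is twice the sum of the winding numbers of the \<open>\<gamma>\<^sub>j\<close>. By the
  argument principle these count the zeros of the \<open>\<gamma>\<^sub>j\<close>, that is the intersections with the hyperplanes.
\<close>

text \<open>A disc is given only through affine charts, and its lift is holomorphic inside but
  merely continuous up to the boundary. Boundary degrees are therefore handled by continuous
  logarithms and homotopies, not by integrals over the unit circle. Index and multiplicities are
  \<open>THE\<close> values over arbitrary choices, so each needs an existence part and an
  invariance part. The matrices \<open>A\<close> need not vary continuously, so
  \<open>A ** transpose A\<close> is compared pointwise with an explicit Lagrangian frame. The
  product of the u_j arises by adding back the radial direction. The vectors (t_j u_j) with t real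
  are the image of R^(n+1) under diag(u). The all-ones vector goes to u itself, and its real
  orthogonal complement goes, up to the factor \<i>, to the tangent space of the torus. Once the
  direction of u is split off, the n-dimensional determinant is that of diag(u), up to constants and
  the determinant of the frame; its square accounts for the factor 2.\<close>

no_notation fps_nth (infixl "$" 75)

section \<open>Winding numbers of functions on the unit circle\<close>
text \<open>The winding number about 0 is the increment of a continuous logarithm divided by 2 pi
  \<i>, and the sum of two logarithms is a logarithm of the product. Only continuity of the paths
  enters, as \<open>homogeneous_lift\<close> promises no more on the boundary.\<close>

lemma winding_number_mult:
  assumes "path p" "0 \<notin> path_image p" "path q" "0 \<notin> path_image q"
  shows "winding_number (\<lambda>t. p t * q t) 0 = winding_number p 0 + winding_number q 0"
proof -
  obtain P where P: "path P" "pathfinish P - pathstart P = 2 * of_real pi * \<i> * winding_number p 0"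
      "\<And>t. t \<in> {0..1} \<Longrightarrow> p t = 0 + exp (P t)"
    using winding_number_as_continuous_log[OF assms(1,2)] by metis
  obtain Q where Q: "path Q" "pathfinish Q - pathstart Q = 2 * of_real pi * \<i> * winding_number q 0"
      "\<And>t. t \<in> {0..1} \<Longrightarrow> q t = 0 + exp (Q t)"
    using winding_number_as_continuous_log[OF assms(3,4)] by metis
  have "winding_number (\<lambda>t. p t * q t) 0 = winding_number (exp \<circ> (\<lambda>t. P t + Q t)) 0"
    by (rule winding_number_cong) (simp add: P(3) Q(3) exp_add)
  also have "\<dots> = (pathfinish (\<lambda>t. P t + Q t) - pathstart (\<lambda>t. P t + Q t)) / (2 * of_real pi * \<i>)"
    by (rule winding_number_compose_exp) (use P(1) Q(1) in \<open>auto simp: path_def intro: continuous_intros\<close>)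
  also have "\<dots> = ((pathfinish P - pathstart P) + (pathfinish Q - pathstart Q)) / (2 * of_real pi * \<i>)"
    by (simp add: pathfinish_def pathstart_def)
  also have "\<dots> = winding_number p 0 + winding_number q 0"
    by (simp add: P(2) Q(2) field_simps)
  finally show ?thesis .
qed

lemma path_circlepath_comp:
  assumes "continuous_on (sphere 0 1) f"
  shows "path (f \<circ> circlepath 0 1)"
  by (rule path_continuous_image) (simp_all add: assms)

lemma circlepath_comp_avoids:
  assumes "\<forall>z\<in>sphere 0 1. f z \<noteq> 0"
  shows "0 \<notin> path_image (f \<circ> circlepath 0 1)"
  using assms by (auto simp: path_image_compose)

lemma winding_number_circle_mult:
  assumes "continuous_on (sphere 0 1) f" "\<forall>z\<in>sphere 0 1. f z \<noteq> 0"
    and "continuous_on (sphere 0 1) g" "\<forall>z\<in>sphere 0 1. g z \<noteq> 0"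
  shows "winding_number ((\<lambda>z. f z * g z) \<circ> circlepath 0 1) 0 =
    winding_number (f \<circ> circlepath 0 1) 0 + winding_number (g \<circ> circlepath 0 1) 0"
  using winding_number_mult[OF path_circlepath_comp circlepath_comp_avoids path_circlepath_comp
      circlepath_comp_avoids, OF assms]
  by (simp add: comp_def)

lemma winding_number_circle_prod:
  assumes "finite I" "\<And>i. i \<in> I \<Longrightarrow> continuous_on (sphere 0 1) (f i)"
    and "\<And>i z. i \<in> I \<Longrightarrow> z \<in> sphere 0 1 \<Longrightarrow> f i z \<noteq> 0"
  shows "winding_number ((\<lambda>z. \<Prod>i\<in>I. f i z) \<circ> circlepath 0 1) 0 =
    (\<Sum>i\<in>I. winding_number (f i \<circ> circlepath 0 1) 0)"
  using assms
proof (induction I rule: finite_induct)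
  case empty
  have "(\<lambda>z. \<Prod>i\<in>{}. f i z) \<circ> circlepath 0 1 = (\<lambda>t. 1)"
    by auto
  then show ?case
    using winding_number_zero_const[of 1 0] by simp
next
  case (insert i I)
  have "winding_number ((\<lambda>z. f i z * (\<Prod>i\<in>I. f i z)) \<circ> circlepath 0 1) 0 =
    winding_number (f i \<circ> circlepath 0 1) 0 + winding_number ((\<lambda>z. \<Prod>i\<in>I. f i z) \<circ> circlepath 0 1) 0"
    by (rule winding_number_circle_mult)
       (use insert in \<open>auto intro!: continuous_on_prod simp: prod_zero_iff\<close>)
  moreover have "winding_number ((\<lambda>z. \<Prod>i\<in>I. f i z) \<circ> circlepath 0 1) 0 =
      (\<Sum>i\<in>I. winding_number (f i \<circ> circlepath 0 1) 0)"
    by (rule insert.IH) (use insert.prems in auto)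
  ultimately show ?case
    using insert.hyps by (simp add: comp_def)
qed

text \<open>The closed disc is contractible, so \<open>f\<close> has a continuous logarithm on it,
  which returns to its initial value after one turn. This disposes of every factor that extends over
  the disc: normalization, unitary frame, change of trivialization.\<close>

lemma winding_number_circle_nonvanishing_on_disc:
  assumes "continuous_on (cball 0 1) f" "\<forall>z\<in>cball 0 1. f z \<noteq> 0"
  shows "winding_number (f \<circ> circlepath 0 1) 0 = 0"
proof -
  obtain g where g: "continuous_on (cball 0 1) g" "\<And>z. z \<in> cball 0 1 \<Longrightarrow> f z = exp (g z)"
    using continuous_logarithm_on_contractible[of "cball 0 1" f] assms
    by (metis convex_cball convex_imp_contractible)
  have in_disc: "circlepath 0 1 t \<in> cball 0 1" for t
    by (simp add: circlepath norm_mult)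
  have "winding_number (f \<circ> circlepath 0 1) 0 = winding_number (exp \<circ> (g \<circ> circlepath 0 1)) 0"
    by (rule winding_number_cong) (simp only: comp_def g(2)[OF in_disc])
  also have "\<dots> = (pathfinish (g \<circ> circlepath 0 1) - pathstart (g \<circ> circlepath 0 1)) / (2 * of_real pi * \<i>)"
    by (rule winding_number_compose_exp, rule path_circlepath_comp)
       (use g(1) continuous_on_subset sphere_cball in blast)
  also have "\<dots> = 0"
    by (simp add: pathfinish_compose pathstart_compose)
  finally show ?thesis .
qed

text \<open>The zeros form a compact subset of the open disc, so the identity theorem leaves
  finitely many unless \<open>f\<close> vanishes throughout, and then continuity would carry the
  zero to the boundary.\<close>

lemma finite_zeros_nonvanishing_sphere:
  assumes cont: "continuous_on (cball 0 1) f" and hol: "f holomorphic_on ball 0 1"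
    and nz: "\<forall>z\<in>sphere (0::complex) 1. f z \<noteq> 0"
  shows "finite {z \<in> cball 0 1. f z = 0}" and "{z \<in> cball 0 1. f z = 0} \<subseteq> ball 0 1"
    and "\<exists>z\<in>ball 0 1. f z \<noteq> 0"
proof -
  have "closed {z \<in> cball 0 1. f z = 0}"
    using continuous_closed_preimage_constant[OF cont closed_cball, of 0] by simp
  moreover have "bounded {z \<in> cball 0 1. f z = 0}"
    by (rule bounded_subset[OF bounded_cball[of 0 1]]) auto
  ultimately have comp: "compact {z \<in> cball 0 1. f z = 0}"
    by (simp add: compact_eq_bounded_closed)
  show sub: "{z \<in> cball 0 1. f z = 0} \<subseteq> ball 0 1"
    using nz by (auto simp: less_le)
  show ex: "\<exists>z\<in>ball 0 1. f z \<noteq> 0"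
  proof (rule ccontr)
    assume "\<not> ?thesis"
    then have "f 1 = 0"
      using continuous_constant_on_closure[of "ball 0 1" f 0 1] cont by auto
    then show False using nz by auto
  qed
  show "finite {z \<in> cball 0 1. f z = 0}"
  proof (cases "f constant_on ball 0 1")
    case True
    with ex have "{z \<in> cball 0 1. f z = 0} = {}"
      using sub by (fastforce simp: constant_on_def)
    then show ?thesis
      by (metis finite.emptyI)
  next
    case False
    have "finite {z \<in> {z \<in> cball 0 1. f z = 0}. f z = 0}"
      by (rule holomorphic_compact_finite_zeros[OF hol open_ball connected_ball comp sub False])
    then show ?thesis
      by simp
  qed
qed

text \<open>Holomorphy stops at the open disc, so the argument principle is used on a circle of
  radius \<open>r < 1\<close> enclosing all zeros. The closed annulus between it and the unit circle
  contains no zero, so a radial homotopy identifies the two winding numbers.\<close>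

lemma winding_number_circle_eq_sum_zorder:
  assumes cont: "continuous_on (cball 0 1) f" and hol: "f holomorphic_on ball 0 1"
    and nz: "\<forall>z\<in>sphere (0::complex) 1. f z \<noteq> 0"
  shows "winding_number (f \<circ> circlepath 0 1) 0 = (\<Sum>p\<in>{z \<in> cball 0 1. f z = 0}. of_int (zorder f p))"
proof -
  define Z where "Z = {z \<in> cball 0 1. f z = 0}"
  have Z: "finite Z" "Z \<subseteq> ball 0 1"
    using finite_zeros_nonvanishing_sphere[OF assms] by (simp_all add: Z_def)
  \<comment> \<open>Inserting 0 makes the maximum exist even if there are no zeros, and keeps the
    midpoint \<open>r\<close> of \<open>r0\<close> and 1 positive.\<close>
  define r0 where "r0 = Max (insert 0 (norm ` Z))"
  define r where "r = (r0 + 1) / 2"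
  have r0: "0 \<le> r0" "\<And>z. z \<in> Z \<Longrightarrow> norm z \<le> r0"
    using Z(1) by (auto simp: r0_def)
  have "r0 < 1"
    using Z by (auto simp: r0_def)
  with r0 have r: "0 < r" "r < 1" "\<And>z. z \<in> Z \<Longrightarrow> norm z < r"
    by (fastforce simp: r_def)+
  have "homotopic_loops (cball 0 1 - Z) (circlepath 0 r) (circlepath 0 1)"
  proof (rule homotopic_loops_linear)
    fix t :: real assume "t \<in> {0..1}"
    show "closed_segment (circlepath 0 r t) (circlepath 0 1 t) \<subseteq> cball 0 1 - Z"
    proof
      fix x assume "x \<in> closed_segment (circlepath 0 r t) (circlepath 0 1 t)"
      then obtain u where u: "0 \<le> u" "u \<le> 1" "x = (1 - u) *\<^sub>R circlepath 0 r t + u *\<^sub>R circlepath 0 1 t"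
        by (auto simp: in_segment)
      have "x = of_real ((1 - u) * r + u) * exp (2 * of_real pi * \<i> * of_real t)"
        by (simp add: u(3) circlepath scaleR_conv_of_real algebra_simps)
      then have "norm x = \<bar>(1 - u) * r + u\<bar>"
        by (simp add: norm_mult del: of_real_add of_real_mult)
      moreover have "r \<le> (1 - u) * r + u"
        using u r mult_left_mono[of r 1 u] by (simp add: algebra_simps)
      moreover have "(1 - u) * r + u \<le> 1"
        using u r mult_left_mono[of r 1 "1 - u"] by (simp add: algebra_simps)
      ultimately have "r \<le> norm x" "norm x \<le> 1"
        using r by auto
      then show "x \<in> cball 0 1 - Z"
        using r(3)[of x] by auto
    qed
  qed auto
  then have "homotopic_loops (- {0}) (f \<circ> circlepath 0 r) (f \<circ> circlepath 0 1)"
    by (rule homotopic_loops_continuous_image)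
       (use cont in \<open>auto simp: Z_def intro: continuous_on_subset\<close>)
  then have "winding_number (f \<circ> circlepath 0 1) 0 = winding_number (f \<circ> circlepath 0 r) 0"
    by (simp add: winding_number_homotopic_loops)
  also have "\<dots> = 1 / (2 * of_real pi * \<i>) * contour_integral (f \<circ> circlepath 0 r) (\<lambda>w. 1 / w)"
  proof -
    have "valid_path (f \<circ> circlepath 0 r)"
      by (rule valid_path_compose_holomorphic[OF _ hol open_ball]) (use r in auto)
    moreover have "0 \<notin> path_image (f \<circ> circlepath 0 r)"
      using r by (force simp: path_image_compose Z_def)
    ultimately show ?thesis
      using winding_number_valid_path[of "f \<circ> circlepath 0 r" 0] by simp
  qed
  also have "contour_integral (f \<circ> circlepath 0 r) (\<lambda>w. 1 / w) =
      contour_integral (circlepath 0 r) (\<lambda>x. deriv f x * 1 / f x)"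
    by (subst contour_integral_comp_analyticW[of f "ball 0 1"])
       (use hol r in \<open>auto simp: analytic_on_open\<close>)
  \<comment> \<open>The argument principle with an empty set of poles and the constant weight
    1.\<close>
  also have "\<dots> = 2 * pi * \<i> * (\<Sum>p\<in>{w \<in> ball 0 1. f w = 0 \<or> w \<in> {}}.
      winding_number (circlepath 0 r) p * 1 * zorder f p)"
  proof (rule argument_principle)
    show "path_image (circlepath 0 r) \<subseteq> ball 0 1 - {w \<in> ball 0 1. f w = 0 \<or> w \<in> {}}"
      using r by (force simp: Z_def)
    show "\<forall>z. z \<notin> ball 0 1 \<longrightarrow> winding_number (circlepath 0 r) z = 0"
    proof (intro allI impI)
      fix z :: complex assume "z \<notin> ball 0 1"
      then show "winding_number (circlepath 0 r) z = 0"
        using winding_number_zero_outside[of "circlepath 0 r" "ball 0 1" z] r by (auto simp: subset_eq)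
    qed
    show "finite {w \<in> ball 0 1. f w = 0 \<or> w \<in> {}}"
      by (rule finite_subset[OF _ Z(1)]) (auto simp: Z_def)
  qed (use hol in auto)
  also have "{w \<in> ball 0 1. f w = 0 \<or> w \<in> {}} = Z"
    using Z(2) by (auto simp: Z_def)
  also have "(\<Sum>p\<in>Z. winding_number (circlepath 0 r) p * 1 * zorder f p) = (\<Sum>p\<in>Z. of_int (zorder f p))"
    by (rule sum.cong) (use r in \<open>auto simp: winding_number_circlepath\<close>)
  finally show ?thesis
    by (simp add: comp_def Z_def)
qed

section \<open>Homogeneous coordinates\<close>
lemma hom_equiv_refl [simp]: "hom_equiv x x \<longleftrightarrow> x \<noteq> 0"
  unfolding hom_equiv_def by (metis vector_smult_lid zero_neq_one)

lemma hpoint_eq_iff: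
  fixes x y :: "complex ^ ('n::finite option)"
  assumes "x \<noteq> 0" "y \<noteq> 0"
  shows "hpoint x = hpoint y \<longleftrightarrow> (\<exists>c. c \<noteq> 0 \<and> y = c *s x)"
  using Quotient_rel[OF Quotient_cproj, of x y] assms by (auto simp: hom_equiv_def)

lemma hpoint_smult:
  fixes x :: "complex ^ ('n::finite option)"
  assumes "x \<noteq> 0" "c \<noteq> 0"
  shows "hpoint (c *s x) = hpoint x"
  using assms hpoint_eq_iff[of x "c *s x"] by (auto simp: vec_eq_iff)

lemma hpoint_surj:
  fixes p :: "'n::finite cproj"
  obtains x where "x \<noteq> 0" "p = hpoint x"
proof
  show "hcoords p \<noteq> 0"
    using Quotient_rep_reflp[OF Quotient_cproj, of p] by simp
  show "p = hpoint (hcoords p)"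
    by (simp add: Quotient_abs_rep[OF Quotient_cproj])
qed

lemma hpoint_in_hyperplane:
  fixes x :: "complex ^ ('n::finite option)"
  assumes "x \<noteq> 0"
  shows "hpoint x \<in> hyperplane i \<longleftrightarrow> x $ i = 0"
  using assms by (auto simp: hyperplane_def hpoint_eq_iff)

lemma hpoint_in_clifford_torus:
  fixes x :: "complex ^ ('n::finite option)"
  assumes "x \<noteq> 0"
  shows "hpoint x \<in> clifford_torus \<longleftrightarrow> (\<forall>i j. norm (x $ i) = norm (x $ j))"
proof
  assume "hpoint x \<in> clifford_torus"
  then obtain y where y: "y \<noteq> 0" "hpoint x = hpoint y" "\<forall>i j. norm (y $ i) = norm (y $ j)"
    by (auto simp: clifford_torus_def)
  then obtain c where "x = c *s y"
    using hpoint_eq_iff[of y x] assms by auto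
  with y(3) show "\<forall>i j. norm (x $ i) = norm (x $ j)"
    by (simp add: norm_mult)
qed (use assms in \<open>auto simp: clifford_torus_def\<close>)

lemma clifford_torus_coord_nonzero:
  fixes x :: "complex ^ ('n::finite option)"
  assumes "x \<noteq> 0" "\<forall>i j. norm (x $ i) = norm (x $ j)"
  shows "x $ i \<noteq> 0"
  using assms by (metis norm_eq_zero vec_eq_iff zero_index)

lemma affine_chart_hpoint:
  assumes "x \<noteq> 0"
  shows "affine_chart i (hpoint x) $ j = x $ j / x $ i"
  using assms by (subst affine_chart.abs_eq) auto

lemma hpoint_affine_chart:
  fixes p :: "'n::finite cproj"
  assumes "p \<notin> hyperplane i"
  shows "affine_chart i p $ i = 1" "affine_chart i p \<noteq> 0" "hpoint (affine_chart i p) = p"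
proof -
  obtain x where x: "x \<noteq> 0" "p = hpoint x"
    by (rule hpoint_surj)
  then have xi: "x $ i \<noteq> 0"
    using assms hpoint_in_hyperplane by blast
  have eq: "affine_chart i p = inverse (x $ i) *s x"
    using x by (simp add: vec_eq_iff affine_chart_hpoint field_simps)
  show "affine_chart i p $ i = 1"
    using xi by (simp add: eq)
  then show "affine_chart i p \<noteq> 0"
    by (metis zero_index zero_neq_one)
  show "hpoint (affine_chart i p) = p"
    unfolding eq using xi x by (simp add: hpoint_smult)
qed

lemma tangent_space_hpoint:
  assumes "x \<noteq> 0"
  shows "tangent_space (hpoint x) = 
    {X. (\<forall>v. cinner (X *v v) x = 0) \<and> (\<forall>v. cinner v x = 0 \<longrightarrow> X *v v = 0)}"
  using assms by (subst tangent_space.abs_eq) auto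

section \<open>Local lifts of a disc and the preimages of the hyperplanes\<close>

lemma holomorphic_disc_local_lift:
  fixes w :: "complex \<Rightarrow> 'n::finite cproj"
  assumes "holomorphic_disc L w" "z0 \<in> cball 0 1"
  obtains V g where "open V" "z0 \<in> V" "\<And>j. continuous_on (V \<inter> cball 0 1) (\<lambda>z. g z $ j)"
    "\<And>z. z \<in> V \<inter> cball 0 1 \<Longrightarrow> g z \<noteq> 0 \<and> w z = hpoint (g z)"
proof -
  obtain i V u where V: "open V" "z0 \<in> V" "smooth_on V u"
      and u: "\<forall>z\<in>V \<inter> cball 0 1. w z \<notin> hyperplane i \<and> affine_chart i (w z) = u z"
    using assms unfolding holomorphic_disc_def smooth_disc_def by meson
  have "continuous_on V u"
    using V(3) Ck_on.simps(1)[of V u] unfolding smooth_on_def by blast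
  then have "continuous_on (V \<inter> cball 0 1) (\<lambda>z. u z $ j)" for j
    by (rule continuous_on_subset[OF continuous_on_component]) auto
  moreover have "u z \<noteq> 0 \<and> w z = hpoint (u z)" if "z \<in> V \<inter> cball 0 1" for z
    using u that hpoint_affine_chart[of "w z" i] by metis
  ultimately show thesis
    using that V by blast
qed

lemma holomorphic_disc_local_holomorphic_lift:
  fixes w :: "complex \<Rightarrow> 'n::finite cproj"
  assumes "holomorphic_disc L w" "z0 \<in> ball 0 1"
  obtains r g where "r > 0" "ball z0 r \<subseteq> ball 0 1" "\<And>j. (\<lambda>z. g z $ j) holomorphic_on ball z0 r"
    "\<And>z. z \<in> ball z0 r \<Longrightarrow> g z \<noteq> 0 \<and> w z = hpoint (g z)"
proof -
  obtain i V where V: "open V" "z0 \<in> V" "V \<subseteq> ball 0 1" "\<forall>z\<in>V. w z \<notin> hyperplane i"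
      "\<forall>j. (\<lambda>z. affine_chart i (w z) $ j) holomorphic_on V"
    using assms unfolding holomorphic_disc_def holomorphic_into_cproj_on_def by meson
  then obtain r where r: "r > 0" "ball z0 r \<subseteq> V"
    using open_contains_ball by blast
  show thesis
  proof (rule that[of r "\<lambda>z. affine_chart i (w z)"])
    show "(\<lambda>z. affine_chart i (w z) $ j) holomorphic_on ball z0 r" for j
      using V r holomorphic_on_subset by blast
    show "affine_chart i (w z) \<noteq> 0 \<and> w z = hpoint (affine_chart i (w z))" if "z \<in> ball z0 r" for z
      using that V(4) r(2) hpoint_affine_chart[of "w z" i] by (metis subsetD)
  qed (use V r in auto)
qed

definition hyperplane_preimage :: "(complex \<Rightarrow> 'n::finite cproj) \<Rightarrow> 'n option \<Rightarrow> complex set" where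
  "hyperplane_preimage w i = {z \<in> cball 0 1. w z \<in> hyperplane i}"

lemma closed_hyperplane_preimage:
  assumes "holomorphic_disc L w"
  shows "closed (hyperplane_preimage w i)"
proof -
  have "z0 \<in> hyperplane_preimage w i" if "\<And>n. f n \<in> hyperplane_preimage w i" "f \<longlonglongrightarrow> z0" for f z0
  proof -
    have z0: "z0 \<in> cball 0 1"
      by (rule closed_sequentially[OF closed_cball _ that(2)])
         (use that(1) in \<open>auto simp: hyperplane_preimage_def\<close>)
    obtain V g where V: "open V" "z0 \<in> V" and cont: "\<And>j. continuous_on (V \<inter> cball 0 1) (\<lambda>z. g z $ j)"
      and g: "\<And>z. z \<in> V \<inter> cball 0 1 \<Longrightarrow> g z \<noteq> 0 \<and> w z = hpoint (g z)"
      using holomorphic_disc_local_lift[OF assms z0] by metis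
    have ev: "eventually (\<lambda>n. f n \<in> V \<inter> cball 0 1) sequentially"
      using topological_tendstoD[OF that(2) V] that(1)
      by (auto simp: hyperplane_preimage_def)
    have "((\<lambda>z. g z $ i) \<longlongrightarrow> g z0 $ i) (at z0 within V \<inter> cball 0 1)"
      using cont[of i] z0 V by (auto simp: continuous_on_def)
    then have "(\<lambda>n. g (f n) $ i) \<longlonglongrightarrow> g z0 $ i"
      using continuous_on_tendsto_compose[OF cont that(2)] ev z0 V by auto
    moreover have "eventually (\<lambda>n. g (f n) $ i = 0) sequentially"
      using ev
    proof eventually_elim
      case (elim n)
      then show ?case
        using that(1)[of n] g[of "f n"] hpoint_in_hyperplane by (auto simp: hyperplane_preimage_def)
    qed
    ultimately have "g z0 $ i = 0"
      by (rule LIMSEQ_unique[OF _ tendsto_eventually])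
    then show ?thesis
      using z0 V g[of z0] hpoint_in_hyperplane by (auto simp: hyperplane_preimage_def)
  qed
  then show ?thesis
    unfolding closed_sequential_limits by blast
qed

lemma hyperplane_preimage_clifford_subset_ball:
  fixes w :: "complex \<Rightarrow> 'n::finite cproj"
  assumes "holomorphic_disc clifford_torus w"
  shows "hyperplane_preimage w i \<subseteq> ball 0 1"
proof
  fix z assume z: "z \<in> hyperplane_preimage w i"
  obtain x where x: "x \<noteq> 0" "w z = hpoint x"
    by (rule hpoint_surj)
  have "w z \<notin> clifford_torus"
    using z x hpoint_in_hyperplane[OF x(1)] hpoint_in_clifford_torus[OF x(1)]
      clifford_torus_coord_nonzero[OF x(1)] by (auto simp: hyperplane_preimage_def)
  then show "z \<in> ball 0 1"
    using z assms by (force simp: hyperplane_preimage_def holomorphic_disc_def less_le)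
qed

text \<open>No global lift is available yet, so the identity theorem is applied locally. The set
  \<open>S\<close> of limit points is closed, and it is open because coordinate \<open>i\<close> of
  a local lift vanishes identically near a limit point of its zeros. As \<open>Z\<close> is closed
  in the plane and lies in the open disc, \<open>S\<close> is clopen in the whole plane and bounded,
  hence empty; compactness then gives finiteness.\<close>

lemma finite_hyperplane_preimage:
  fixes w :: "complex \<Rightarrow> 'n::finite cproj"
  assumes w: "holomorphic_disc clifford_torus w"
  shows "finite (hyperplane_preimage w i)"
proof -
  define Z where "Z = hyperplane_preimage w i"
  define S where "S = {z. z islimpt Z}"
  have "closed Z" and Z: "Z \<subseteq> ball 0 1"
    using closed_hyperplane_preimage[OF w] hyperplane_preimage_clifford_subset_ball[OF w]
    by (auto simp: Z_def)
  have SZ: "S \<subseteq> Z"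
    using \<open>closed Z\<close> by (auto simp: S_def closed_limpt)
  have "open S"
    unfolding open_contains_ball
  proof
    fix z0 assume z0: "z0 \<in> S"
    obtain r g where r: "r > 0" "ball z0 r \<subseteq> ball 0 1" 
        and hol: "\<And>j. (\<lambda>z. g z $ j) holomorphic_on ball z0 r"
        and g: "\<And>z. z \<in> ball z0 r \<Longrightarrow> g z \<noteq> 0 \<and> w z = hpoint (g z)"
      using holomorphic_disc_local_holomorphic_lift[OF w] z0 SZ Z by (metis subsetD)
    have Zg: "z \<in> Z \<longleftrightarrow> g z $ i = 0" if "z \<in> ball z0 r" for z
      using that r g[OF that] hpoint_in_hyperplane[of "g z" i]
      by (auto simp: Z_def hyperplane_preimage_def dest: less_imp_le)
    have "z0 islimpt Z \<inter> ball z0 r"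
      by (rule islimpt_Int_eventually) (use z0 r eventually_at_in_open'[of "ball z0 r" z0] in \<open>auto simp: S_def\<close>)
    then have "g z $ i = 0" if "z \<in> ball z0 r" for z
      using analytic_continuation[OF hol[of i] open_ball connected_ball, of "Z \<inter> ball z0 r" z0 z] Zg that r
      by auto
    then have "ball z0 r \<subseteq> Z"
      using Zg by blast
    then have "ball z0 r \<subseteq> S"
      using islimpt_subset[of _ "ball z0 r" Z] interior_limit_point[of _ "ball z0 r"]
      unfolding S_def interior_ball by blast
    with r show "\<exists>e>0. ball z0 e \<subseteq> S"
      by blast
  qed
  moreover have "closed S"
    by (simp add: S_def closed_limpts)
  ultimately have "S = {} \<or> S = UNIV"
    using clopen by blast
  moreover have "S \<noteq> UNIV"
    using SZ Z by (metis UNIV_I centre_in_ball mem_ball_0 norm_one less_irrefl subsetD)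
  ultimately have "S = {}"
    by blast
  then have "finite (cball 0 1 \<inter> Z)"
    by (intro finite_not_islimpt_in_compact) (auto simp: S_def)
  moreover have "cball 0 1 \<inter> Z = Z"
    using Z by fastforce
  ultimately show ?thesis
    by (simp add: Z_def)
qed

section \<open>Homogeneous lifts and intersection multiplicities\<close>
text \<open>Dividing a local lift by the zero-free factor of its coordinate \<open>i\<close> turns
  that coordinate into an exact power of \<open>z - p\<close>. The denominators of the affine chart
  can then be cleared by a polynomial, with no unknown units left over.\<close>

lemma holomorphic_disc_hyperplane_coordinate:
  fixes w :: "complex \<Rightarrow> 'n::finite cproj"
  assumes w: "holomorphic_disc clifford_torus w" and p: "p \<in> hyperplane_preimage w i"
  obtains m r G where "r > 0" "ball p r \<subseteq> ball 0 1" "\<And>j. (\<lambda>z. G z $ j) holomorphic_on ball p r"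
    "\<And>z. z \<in> ball p r \<Longrightarrow> G z \<noteq> 0 \<and> w z = hpoint (G z) \<and> G z $ i = (z - p) ^ m"
proof -
  have "p \<in> ball 0 1"
    using p hyperplane_preimage_clifford_subset_ball[OF w] by blast
  then obtain r g where r: "r > 0" "ball p r \<subseteq> ball 0 1"
      and hol: "\<And>j. (\<lambda>z. g z $ j) holomorphic_on ball p r"
      and g: "\<And>z. z \<in> ball p r \<Longrightarrow> g z \<noteq> 0 \<and> w z = hpoint (g z)"
    using holomorphic_disc_local_holomorphic_lift[OF w] by metis
  have Zg: "z \<in> hyperplane_preimage w i \<longleftrightarrow> g z $ i = 0" if "z \<in> ball p r" for z
    using that r g[OF that] hpoint_in_hyperplane[of "g z" i]
    by (auto simp: hyperplane_preimage_def dest: less_imp_le)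
  \<comment> \<open>A finite order of vanishing requires this; otherwise a whole ball would lie in
    the finite preimage.\<close>
  have "\<exists>z\<in>ball p r. g z $ i \<noteq> 0"
  proof (rule ccontr)
    assume "\<not> ?thesis"
    then have "ball p r \<subseteq> hyperplane_preimage w i"
      using Zg by blast
    then have "finite (ball p r)"
      using finite_hyperplane_preimage[OF w] finite_subset by blast
    then show False
      using r uncountable_ball countable_finite by blast
  qed
  moreover have "g p $ i = 0"
    using p Zg r by simp
  ultimately obtain r' where r': "r' > 0" "cball p r' \<subseteq> ball p r"
      and hol': "zor_poly (\<lambda>z. g z $ i) p holomorphic_on cball p r'"
      and k: "\<And>z. z \<in> cball p r' \<Longrightarrow> g z $ i = zor_poly (\<lambda>z. g z $ i) p z * (z - p) ^ nat (zorder (\<lambda>z. g z $ i) p)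
        \<and> zor_poly (\<lambda>z. g z $ i) p z \<noteq> 0"
    using zorder_exist_zero[OF hol[of i] open_ball connected_ball, of p] r by auto
  let ?k = "zor_poly (\<lambda>z. g z $ i) p"
  let ?G = "\<lambda>z. inverse (?k z) *s g z"
  show thesis
  proof (rule that[of r' ?G "nat (zorder (\<lambda>z. g z $ i) p)"])
    show "ball p r' \<subseteq> ball 0 1"
      using r r' ball_subset_cball by blast
    show "(\<lambda>z. ?G z $ j) holomorphic_on ball p r'" for j
    proof -
      have "(\<lambda>z. g z $ j) holomorphic_on ball p r'" "?k holomorphic_on ball p r'"
        using hol hol' r' ball_subset_cball holomorphic_on_subset by (metis (no_types, lifting) order_trans)+
      then show ?thesis
        using k ball_subset_cball by (auto intro!: holomorphic_intros)
    qed
    fix z assume "z \<in> ball p r'"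
    then have z: "z \<in> cball p r'" "z \<in> ball p r"
      using r'(2) ball_subset_cball[of p r'] by blast+
    show "?G z \<noteq> 0 \<and> w z = hpoint (?G z) \<and> ?G z $ i = (z - p) ^ nat (zorder (\<lambda>z. g z $ i) p)"
    proof (intro conjI)
      show "?G z \<noteq> 0"
        using g[OF z(2)] k[OF z(1)] by (simp add: vec_eq_iff)
      show "w z = hpoint (?G z)"
        using g[OF z(2)] k[OF z(1)] hpoint_smult[of "g z" "inverse (?k z)"] by simp
      have "?G z $ i = inverse (?k z) * (?k z * (z - p) ^ nat (zorder (\<lambda>z. g z $ i) p))"
        using k[OF z(1)] by simp
      then show "?G z $ i = (z - p) ^ nat (zorder (\<lambda>z. g z $ i) p)"
        using k[OF z(1)] by simp
    qed
  qed (use r' in auto)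
qed

text \<open>
  The affine chart is meromorphic with poles in \<open>Z\<close>; the lift is obtained by clearing denominators
  with the polynomial \<open>P Z\<close>.
\<close>

lemma homogeneous_lift_exists:
  fixes w :: "complex \<Rightarrow> 'n::finite cproj"
  assumes w: "holomorphic_disc clifford_torus w"
  obtains \<gamma> where "homogeneous_lift w \<gamma>"
proof -
  define Z where "Z = hyperplane_preimage w None"
  have Z: "finite Z" "Z \<subseteq> ball 0 1"
    using finite_hyperplane_preimage[OF w] hyperplane_preimage_clifford_subset_ball[OF w]
    by (simp_all add: Z_def)
  \<comment> \<open>Bundling the data into one predicate lets \<open>m\<close>, \<open>r\<close> and
    \<open>G\<close> be chosen together as functions of the point of \<open>Z\<close>.\<close>
  define Q where "Q p m r G \<longleftrightarrow> r > 0 \<and> ball p r \<subseteq> ball 0 1 \<and> (\<forall>j. (\<lambda>z. G z $ j) holomorphic_on ball p r) \<and>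
    (\<forall>z\<in>ball p r. G z \<noteq> 0 \<and> w z = hpoint (G z) \<and> G z $ None = (z - p) ^ m)"
    for p r m and G :: "complex \<Rightarrow> complex ^ ('n option)"
  have "\<exists>m r G. Q p m r G" if p: "p \<in> Z" for p
  proof (rule holomorphic_disc_hyperplane_coordinate[OF w p[unfolded Z_def]])
    fix m r G
    assume "r > 0" "ball p r \<subseteq> ball 0 1" "\<And>j. (\<lambda>z. G z $ j) holomorphic_on ball p r"
      "\<And>z. z \<in> ball p r \<Longrightarrow> G z \<noteq> 0 \<and> w z = hpoint (G z) \<and> G z $ None = (z - p) ^ m"
    then have "Q p m r G"
      unfolding Q_def by blast
    then show ?thesis
      by blast
  qed
  then obtain m r G where Q: "\<And>p. p \<in> Z \<Longrightarrow> Q p (m p) (r p) (G p)"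
    by metis
  have r: "r p > 0" "ball p (r p) \<subseteq> ball 0 1"
    and hol: "(\<lambda>z. G p z $ j) holomorphic_on ball p (r p)"
    and G: "z \<in> ball p (r p) \<Longrightarrow> G p z \<noteq> 0 \<and> w z = hpoint (G p z) \<and> G p z $ None = (z - p) ^ m p"
    if "p \<in> Z" for p j z
    using Q[OF that] unfolding Q_def by blast+
  define P where "P S z = (\<Prod>p\<in>S. (z - p) ^ m p)" for S z
  have P_nz: "P S z \<noteq> 0" if "finite S" "z \<notin> S" for S z
    using that by (auto simp: P_def)
  \<comment> \<open>Near a point p of \<open>Z\<close> the chart is \<open>G p\<close> divided by
    \<open>(z - p) ^ m p\<close>. This divisor cancels the factor of \<open>P Z\<close> belonging to
    p, so the continued value at p is \<open>P (Z - {p}) p\<close> times \<open>G p p\<close>, which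
    is again nonzero.\<close>
  define \<gamma> where "\<gamma> z = (if z \<in> Z then P (Z - {z}) z *s G z z else P Z z *s affine_chart None (w z))" for z
  have not_Z: "w z \<notin> hyperplane None" if "z \<in> cball 0 1" "z \<notin> Z" for z
    using that by (auto simp: Z_def hyperplane_preimage_def)
  have lift: "\<gamma> z \<noteq> 0 \<and> w z = hpoint (\<gamma> z)" if z: "z \<in> cball 0 1" for z
  proof (cases "z \<in> Z")
    case True
    then show ?thesis
      using G[of z z] r(1)[of z] P_nz[of "Z - {z}" z] Z(1)
      by (auto simp: \<gamma>_def hpoint_smult)
  next
    case False
    then show ?thesis
      using hpoint_affine_chart[OF not_Z[OF z False]] P_nz[of Z z] Z(1)
      by (auto simp: \<gamma>_def hpoint_smult)
  qed
  have chart: "\<gamma> z $ j = P Z z * (g z $ j / g z $ None)"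
    if "z \<notin> Z" "g z \<noteq> 0" "w z = hpoint (g z)" for z j and g :: "complex \<Rightarrow> complex ^ ('n option)"
    using that by (simp add: \<gamma>_def affine_chart_hpoint)
  \<comment> \<open>Boundary points lie outside \<open>Z\<close>, so there the lift is a quotient of
    continuous functions with nonzero denominator.\<close>
  have cont: "continuous (at z0 within cball 0 1) (\<lambda>z. \<gamma> z $ j)" if z0: "z0 \<in> sphere 0 1" for z0 j
  proof -
    have "z0 \<in> cball 0 1" "z0 \<notin> Z"
      using z0 Z(2) by auto
    obtain V g where V: "open V" "z0 \<in> V" and cont: "\<And>j. continuous_on (V \<inter> cball 0 1) (\<lambda>z. g z $ j)"
      and g: "\<And>z. z \<in> V \<inter> cball 0 1 \<Longrightarrow> g z \<noteq> 0 \<and> w z = hpoint (g z)"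
      using holomorphic_disc_local_lift[OF w \<open>z0 \<in> cball 0 1\<close>] by metis
    have gnz: "g z $ None \<noteq> 0" if "z \<in> (V - Z) \<inter> cball 0 1" for z
      using that hpoint_in_hyperplane[of "g z" None] g by (auto simp: Z_def hyperplane_preimage_def)
    have "continuous_on ((V - Z) \<inter> cball 0 1) (\<lambda>z. g z $ l)" for l
      by (rule continuous_on_subset[OF cont]) auto
    then have "continuous_on ((V - Z) \<inter> cball 0 1) (\<lambda>z. P Z z * (g z $ j / g z $ None))"
      unfolding P_def using gnz
      by (intro continuous_on_mult continuous_on_prod continuous_on_power continuous_on_diff continuous_on_id
          continuous_on_const continuous_on_divide) auto
    then have "continuous_on ((V - Z) \<inter> cball 0 1) (\<lambda>z. \<gamma> z $ j)"
      by (rule continuous_on_eq) (rule chart[symmetric], use g in auto)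
    moreover have z0V: "z0 \<in> V - Z" "open (V - Z)"
      using V \<open>z0 \<notin> Z\<close> Z(1) by (auto simp: open_Diff finite_imp_closed)
    moreover have "at z0 within (V - Z) \<inter> cball 0 1 = at z0 within cball 0 1"
      by (rule at_within_nhd[OF z0V]) auto
    ultimately show ?thesis
      using \<open>z0 \<in> cball 0 1\<close> unfolding continuous_on_eq_continuous_within by (metis IntI)
  qed
  have "(\<lambda>z. \<gamma> z $ j) analytic_on {z0}" if z0: "z0 \<in> ball 0 1" for z0 j
  proof (cases "z0 \<in> Z")
    case True
    have "\<gamma> z $ j = P (Z - {z0}) z * G z0 z $ j" if z: "z \<in> ball z0 (r z0)" for z
    proof (cases "z = z0")
      case False
      \<comment> \<open>Coordinate \<open>None\<close> of \<open>G z0\<close> is a power of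
        \<open>z - z0\<close>, so this ball contains no second point of \<open>Z\<close>.\<close>
      have nz: "G z0 z $ None \<noteq> 0"
        using G[OF True z] False by simp
      then have "w z \<notin> hyperplane None"
        using hpoint_in_hyperplane G[OF True z] by metis
      then have "z \<notin> Z"
        by (simp add: Z_def hyperplane_preimage_def)
      moreover have "P Z z = (z - z0) ^ m z0 * P (Z - {z0}) z"
        unfolding P_def by (rule prod.remove[OF Z(1) True])
      ultimately show ?thesis
        using chart[of z "G z0" j] G[OF True z] False by simp
    qed (use True in \<open>simp add: \<gamma>_def\<close>)
    moreover have "(\<lambda>z. P (Z - {z0}) z * G z0 z $ j) holomorphic_on ball z0 (r z0)"
      unfolding P_def by (intro holomorphic_intros hol[OF True])
    ultimately have "(\<lambda>z. \<gamma> z $ j) holomorphic_on ball z0 (r z0)"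
      by (subst holomorphic_cong[OF refl]) auto
    then show ?thesis
      using r(1)[OF True] unfolding analytic_at_ball by blast
  next
    case False
    obtain r' g where r': "r' > 0" "ball z0 r' \<subseteq> ball 0 1"
        and hol': "\<And>j. (\<lambda>z. g z $ j) holomorphic_on ball z0 r'"
        and g: "\<And>z. z \<in> ball z0 r' \<Longrightarrow> g z \<noteq> 0 \<and> w z = hpoint (g z)"
      using holomorphic_disc_local_holomorphic_lift[OF w z0] by metis
    have "open (ball z0 r' - Z)"
      using Z(1) by (simp add: open_Diff finite_imp_closed)
    have gnz: "g z $ None \<noteq> 0" if "z \<in> ball z0 r' - Z" for z
      using that hpoint_in_hyperplane[of "g z" None] g r' ball_subset_cball
      by (auto simp: Z_def hyperplane_preimage_def)
    have "(\<lambda>z. g z $ l) holomorphic_on ball z0 r' - Z" for l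
      by (rule holomorphic_on_subset[OF hol']) auto
    then have "(\<lambda>z. P Z z * (g z $ j / g z $ None)) holomorphic_on ball z0 r' - Z"
      unfolding P_def by (intro holomorphic_intros) (use gnz in auto)
    then have "(\<lambda>z. \<gamma> z $ j) holomorphic_on ball z0 r' - Z"
      by (rule holomorphic_transform) (rule chart[symmetric], use g in auto)
    with \<open>open (ball z0 r' - Z)\<close> show ?thesis
      using False r' analytic_at by fastforce
  qed
  then have hol\<gamma>: "(\<lambda>z. \<gamma> z $ j) holomorphic_on ball 0 1" for j
    by (meson analytic_imp_holomorphic analytic_on_analytic_at)
  have "continuous_on (cball 0 1) (\<lambda>z. \<gamma> z $ j)" for j
    unfolding continuous_on_eq_continuous_within
  proof
    fix z0 :: complex assume z0: "z0 \<in> cball 0 1"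
    show "continuous (at z0 within cball 0 1) (\<lambda>z. \<gamma> z $ j)"
    proof (cases "z0 \<in> ball 0 1")
      case True
      then show ?thesis
        using holomorphic_on_imp_continuous_on[OF hol\<gamma>[of j]]
        by (meson continuous_at_imp_continuous_within continuous_on_eq_continuous_at open_ball)
    qed (use z0 cont in auto)
  qed
  then show thesis
    using hol\<gamma> lift by (intro that[of \<gamma>]) (auto simp: homogeneous_lift_def)
qed

text \<open>Near \<open>p\<close> two lifts differ by the quotient \<open>c\<close> of a coordinate
  that is nonzero at \<open>p\<close>; it is holomorphic and zero-free there. Orders of vanishing
  add under multiplication, and \<open>c\<close> contributes 0.\<close>

lemma homogeneous_lift_vanishing_order_unique:
  fixes w :: "complex \<Rightarrow> 'n::finite cproj"
  assumes w: "holomorphic_disc clifford_torus w"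
    and lift: "homogeneous_lift w \<gamma>" "homogeneous_lift w \<delta>" and p: "p \<in> ball 0 1"
  shows "vanishing_order (\<lambda>z. \<gamma> z $ i) p = vanishing_order (\<lambda>z. \<delta> z $ i) p"
proof -
  have cont: "continuous_on (cball 0 1) (\<lambda>z. \<gamma> z $ j)" and hol: "(\<lambda>z. \<gamma> z $ j) holomorphic_on ball 0 1"
    "(\<lambda>z. \<delta> z $ j) holomorphic_on ball 0 1" for j
    using lift by (auto simp: homogeneous_lift_def)
  have nz: "\<gamma> z \<noteq> 0" "\<delta> z \<noteq> 0" "w z = hpoint (\<gamma> z)" "w z = hpoint (\<delta> z)" if "z \<in> ball 0 1" for z
    using lift that by (auto simp: homogeneous_lift_def)
  obtain k where k: "\<gamma> p $ k \<noteq> 0"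
    using nz(1)[OF p] by (auto simp: vec_eq_iff)
  define U where "U = {z \<in> ball 0 1. \<gamma> z $ k \<noteq> 0}"
  have "open U"
    using continuous_open_preimage[OF holomorphic_on_imp_continuous_on[OF hol(1)[of k]] open_ball, of "- {0}"]
    by (auto simp: U_def vimage_def Int_def open_Compl)
  have U: "p \<in> U" "U \<subseteq> ball 0 1"
    using k p by (auto simp: U_def)
  define c where "c z = \<delta> z $ k / \<gamma> z $ k" for z
  have "c holomorphic_on U"
    unfolding c_def using hol U(2) by (intro holomorphic_intros) (auto intro: holomorphic_on_subset simp: U_def)
  then have an: "c analytic_on {p}"
    using \<open>open U\<close> U(1) analytic_at by blast
  have c: "\<delta> z $ j = c z * \<gamma> z $ j" "c z \<noteq> 0" if z: "z \<in> U" for z j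
  proof -
    obtain d where "d \<noteq> 0" "\<delta> z = d *s \<gamma> z"
      using hpoint_eq_iff[of "\<gamma> z" "\<delta> z"] nz[OF subsetD[OF U(2) z]] by auto
    then show "\<delta> z $ j = c z * \<gamma> z $ j" "c z \<noteq> 0"
      using z by (auto simp: c_def U_def)
  qed
  have evU: "eventually (\<lambda>z. z \<in> U) (at p)"
    using \<open>open U\<close> U(1) by (rule eventually_at_in_open')
  have "zorder (\<lambda>z. \<delta> z $ i) p = zorder (\<lambda>z. c z * \<gamma> z $ i) p"
    by (rule zorder_cong[OF eventually_mono[OF evU] refl]) (rule c(1))
  also have "\<dots> = zorder c p + zorder (\<lambda>z. \<gamma> z $ i) p"
  proof (rule zorder_times_analytic[OF an])
    show "(\<lambda>z. \<gamma> z $ i) analytic_on {p}"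
      using hol(1)[of i] p analytic_at by blast
    \<comment> \<open>Additivity of \<open>zorder\<close> asks for a product that is nonzero in a
      punctured neighbourhood of \<open>p\<close>; finiteness of the preimage supplies it.\<close>
    have "eventually (\<lambda>z. z \<notin> hyperplane_preimage w i) (at p)"
      using finite_hyperplane_preimage[OF w, of i] islimpt_finite islimpt_iff_eventually by blast
    then show "eventually (\<lambda>z. c z * \<gamma> z $ i \<noteq> 0) (at p)"
      using evU
    proof eventually_elim
      case (elim z)
      then have "\<gamma> z $ i \<noteq> 0"
        using nz[of z] U(2) hpoint_in_hyperplane[of "\<gamma> z" i] by (auto simp: hyperplane_preimage_def)
      then show ?case
        using c(2)[of z] elim by simp
    qed
  qed
  also have "zorder c p = 0"
    using an c(2) U(1) by (intro zorder_eq_0I) auto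
  finally have "zorder (\<lambda>z. \<delta> z $ i) p = zorder (\<lambda>z. \<gamma> z $ i) p"
    by simp
  then show ?thesis
    using c(1)[OF U(1), of i] c(2)[OF U(1)] by (simp add: vanishing_order_def)
qed

lemma intersection_multiplicity_eq_vanishing_order:
  fixes w :: "complex \<Rightarrow> 'n::finite cproj"
  assumes w: "holomorphic_disc clifford_torus w"
    and lift: "homogeneous_lift w \<gamma>" and p: "p \<in> ball 0 1"
  shows "intersection_multiplicity w i p = vanishing_order (\<lambda>z. \<gamma> z $ i) p"
  unfolding intersection_multiplicity_def
proof (rule the_equality)
  show "\<exists>\<delta>. homogeneous_lift w \<delta> \<and> vanishing_order (\<lambda>z. \<gamma> z $ i) p = vanishing_order (\<lambda>z. \<delta> z $ i) p"
    using lift by blast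
  show "m = vanishing_order (\<lambda>z. \<gamma> z $ i) p"
    if "\<exists>\<delta>. homogeneous_lift w \<delta> \<and> m = vanishing_order (\<lambda>z. \<delta> z $ i) p" for m
    using that homogeneous_lift_vanishing_order_unique[OF w _ lift p] by blast
qed

lemma total_multiplicity_eq_sum_zorder:
  fixes w :: "complex \<Rightarrow> 'n::finite cproj"
  assumes w: "holomorphic_disc clifford_torus w" and lift: "homogeneous_lift w \<gamma>"
  shows "int (total_multiplicity w i) = (\<Sum>p\<in>{z \<in> cball 0 1. \<gamma> z $ i = 0}. zorder (\<lambda>z. \<gamma> z $ i) p)"
proof -
  have eq: "{p \<in> cball 0 1. w p \<in> hyperplane i} = {z \<in> cball 0 1. \<gamma> z $ i = 0}"
    using lift by (auto simp: homogeneous_lift_def hpoint_in_hyperplane)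
  have "int (total_multiplicity w i) = (\<Sum>p\<in>{z \<in> cball 0 1. \<gamma> z $ i = 0}. int (intersection_multiplicity w i p))"
    unfolding total_multiplicity_def eq by simp
  also have "\<dots> = (\<Sum>p\<in>{z \<in> cball 0 1. \<gamma> z $ i = 0}. zorder (\<lambda>z. \<gamma> z $ i) p)"
  proof (rule sum.cong[OF refl])
    fix p assume "p \<in> {z \<in> cball 0 1. \<gamma> z $ i = 0}"
    then have p: "p \<in> ball 0 1" "\<gamma> p $ i = 0"
      using hyperplane_preimage_clifford_subset_ball[OF w, of i] eq by (auto simp: hyperplane_preimage_def)
    have hol: "(\<lambda>z. \<gamma> z $ i) holomorphic_on ball 0 1"
      using lift by (simp add: homogeneous_lift_def)
    have "\<exists>z\<in>ball 0 1. \<gamma> z $ i \<noteq> 0"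
    proof (rule ccontr)
      assume "\<not> ?thesis"
      then have "ball 0 1 \<subseteq> hyperplane_preimage w i"
        using eq by (force simp: hyperplane_preimage_def)
      then have "finite (ball (0::complex) 1)"
        using finite_hyperplane_preimage[OF w] finite_subset by blast
      then show False
        using uncountable_ball[of 1 "0::complex"] countable_finite by (meson zero_less_one)
    qed
    \<comment> \<open>Positivity of the order guarantees that \<open>nat\<close> in
      \<open>vanishing_order\<close> truncates nothing.\<close>
    then have "zorder (\<lambda>z. \<gamma> z $ i) p > 0"
      using zorder_exist_zero[OF hol open_ball connected_ball p(1)] p(2) by auto
    then show "int (intersection_multiplicity w i p) = zorder (\<lambda>z. \<gamma> z $ i) p"
      using p intersection_multiplicity_eq_vanishing_order[OF w lift p(1)] by (simp add: vanishing_order_def)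
  qed
  finally show ?thesis .
qed

section \<open>Unitary matrices\<close>
lemma cinner_add_left: "cinner (x + y) z = cinner x z + cinner y z"
  by (simp add: cinner_def algebra_simps sum.distrib)

lemma cinner_add_right: "cinner x (y + z) = cinner x y + cinner x z"
  by (simp add: cinner_def algebra_simps sum.distrib)

lemma cinner_diff_left: "cinner (x - y) z = cinner x z - cinner y z"
  by (simp add: cinner_def algebra_simps sum_subtractf)

lemma cinner_diff_right: "cinner x (y - z) = cinner x y - cinner x z"
  by (simp add: cinner_def algebra_simps sum_subtractf)

lemma cinner_smult_left: "cinner (c *s x) y = c * cinner x y"
  by (simp add: cinner_def sum_distrib_left algebra_simps)

lemma cinner_smult_right: "cinner x (c *s y) = cnj c * cinner x y"
  by (simp add: cinner_def sum_distrib_left algebra_simps)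

lemma cinner_commute: "cinner x y = cnj (cinner y x)"
  by (simp add: cinner_def algebra_simps)

lemma cinner_self: "cinner x x = of_real ((norm x)\<^sup>2)"
  by (simp add: cinner_def norm_vec_def L2_set_def sum_nonneg flip: complex_norm_square)

lemma cinner_axis_left: "cinner (axis i 1) x = cnj (x $ i)"
  by (simp add: cinner_def axis_def if_distrib[of "\<lambda>a. a * b" for b] cong: if_cong)

lemma cinner_axis_right: "cinner x (axis i 1) = x $ i"
  using cinner_commute[of x "axis i 1"] by (simp add: cinner_axis_left)

lemmas cinner_simps = cinner_add_left cinner_add_right cinner_diff_left cinner_diff_right
  cinner_smult_left cinner_smult_right

lemma matrix_entry_eq_cinner: "A $ i $ j = cinner (A *v axis j 1) (axis i 1)"
  unfolding cinner_axis_right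
  by (simp add: matrix_vector_mult_def axis_def if_distrib[of "\<lambda>a. b * a" for b] cong: if_cong)

definition conj_transpose :: "complex ^ 'n ^ 'm \<Rightarrow> complex ^ 'm ^ 'n" where
  "conj_transpose A = (\<chi> i j. cnj (A $ j $ i))"

lemma cinner_mult_left: "cinner (A *v x) y = cinner x (conj_transpose A *v y)"
  unfolding cinner_def conj_transpose_def matrix_vector_mult_def
  by (simp add: sum_distrib_left sum_distrib_right mult_ac) (rule sum.swap)

lemma conj_transpose_conj_transpose [simp]: "conj_transpose (conj_transpose A) = A"
  by (simp add: conj_transpose_def vec_eq_iff)

lemma det_conj_transpose: "det (conj_transpose A) = cnj (det A)"
proof -
  have "det (conj_transpose A) = det (transpose (conj_transpose A))"
    by simp
  also have "\<dots> = cnj (det A)"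
    by (simp add: det_def conj_transpose_def transpose_def)
  finally show ?thesis .
qed

lemma unitary_matrix_iff: "unitary_matrix A \<longleftrightarrow> A ** conj_transpose A = mat 1"
  by (simp add: unitary_matrix_def conj_transpose_def)

lemma unitary_matrix_iff': "unitary_matrix A \<longleftrightarrow> conj_transpose A ** A = mat 1"
  unfolding unitary_matrix_iff by (rule matrix_left_right_inverse)

lemma unitary_matrix_iff_isometry:
  "unitary_matrix A \<longleftrightarrow> (\<forall>x y. cinner (A *v x) (A *v y) = cinner x y)"
proof
  assume "unitary_matrix A"
  then show "\<forall>x y. cinner (A *v x) (A *v y) = cinner x y"
    by (simp add: cinner_mult_left matrix_vector_mul_assoc unitary_matrix_iff')
next
  assume iso: "\<forall>x y. cinner (A *v x) (A *v y) = cinner x y"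
  have "(conj_transpose A ** A) $ i $ j = (mat 1 :: complex ^ 'a ^ 'a) $ i $ j" for i j
  proof -
    have "(conj_transpose A ** A) $ i $ j = cinner (conj_transpose A *v (A *v axis j 1)) (axis i 1)"
      by (simp add: matrix_entry_eq_cinner[of "conj_transpose A ** A"] matrix_vector_mul_assoc)
    also have "\<dots> = cinner (axis j 1) (axis i 1)"
      using cinner_mult_left[of "conj_transpose A" "A *v axis j 1" "axis i 1"] iso by simp
    finally show ?thesis
      unfolding cinner_axis_right by (simp add: mat_def axis_def)
  qed
  then show "unitary_matrix A"
    by (simp add: unitary_matrix_iff' vec_eq_iff)
qed

lemma unitary_matrix_mult: "unitary_matrix A \<Longrightarrow> unitary_matrix B \<Longrightarrow> unitary_matrix (A ** B)"
  by (simp add: unitary_matrix_iff_isometry flip: matrix_vector_mul_assoc)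

lemma unitary_matrix_conj_transpose: "unitary_matrix A \<Longrightarrow> unitary_matrix (conj_transpose A)"
  by (metis conj_transpose_conj_transpose unitary_matrix_iff unitary_matrix_iff')

lemma det_unitary_matrix_nonzero: "unitary_matrix A \<Longrightarrow> det A \<noteq> 0"
  unfolding unitary_matrix_iff by (metis det_I det_mul mult_zero_left zero_neq_one)

lemma unitary_matrix_cancel:
  assumes "unitary_matrix A"
  shows "A *v (conj_transpose A *v x) = x" "conj_transpose A *v (A *v x) = x"
  using assms by (simp_all add: matrix_vector_mul_assoc unitary_matrix_iff unitary_matrix_iff'[of A, symmetric])
     (use assms unitary_matrix_iff' in \<open>metis matrix_vector_mul_lid\<close>)

section \<open>Unitary reflections and continuous unitary frames\<close>

definition reflection_onto :: "complex ^ 'm \<Rightarrow> complex ^ 'm \<Rightarrow> complex ^ 'm ^ 'm" where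
  "reflection_onto a b =
    (\<chi> i j. (a + b) $ i * cnj ((a + b) $ j) / (1 + cinner a b) - (if i = j then 1 else 0))"

lemma reflection_onto_mult:
  "reflection_onto a b *v x = (cinner x (a + b) / (1 + cinner a b)) *s (a + b) - x"
proof -
  define c where "c = a + b"
  define t where "t = 1 + cinner a b"
  have "(reflection_onto a b *v x) $ i = (cinner x c / t) * c $ i - x $ i" for i
  proof -
    have "(reflection_onto a b *v x) $ i = (\<Sum>j\<in>UNIV. c $ i / t * (x $ j * cnj (c $ j)) - (if i = j then x $ j else 0))"
      unfolding matrix_vector_mult_def reflection_onto_def c_def[symmetric] t_def[symmetric]
      by (simp, rule sum.cong) (auto simp: left_diff_distrib right_diff_distrib mult_ac)
    also have "\<dots> = c $ i / t * cinner x c - x $ i"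
      by (simp add: sum_subtractf cinner_def sum_distrib_left sum_divide_distrib)
    finally show ?thesis
      by simp
  qed
  then show ?thesis
    by (simp add: vec_eq_iff c_def t_def distrib_left add_divide_distrib)
qed

text \<open>Since |c|^2 = t + cnj t, the map is -1 on the orthogonal complement of \<open>c\<close>
  and multiplication by the unimodular number cnj t / t on \<open>c\<close>. If
  \<open>cinner a b\<close> is real, this is the half turn about the line of \<open>c\<close>;
  dividing by \<open>t\<close> rather than by |c|^2 / 2 sends \<open>a\<close> exactly to
  \<open>b\<close> in the complex case as well, because \<open>cinner a c = t\<close>.\<close>

lemma reflection_onto:
  assumes ab: "norm a = 1" "norm b = 1" "cinner a b \<noteq> - 1"
  shows "unitary_matrix (reflection_onto a b)" "reflection_onto a b *v a = b"
proof -
  define t where "t = 1 + cinner a b"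
  define c where "c = a + b"
  have t: "t \<noteq> 0"
    using ab(3) by (simp add: t_def add_eq_0_iff)
  have "cinner c c = t + cnj t"
    using ab cinner_commute[of b a] unfolding c_def t_def cinner_simps
    by (simp add: cinner_self[of a] cinner_self[of b])
  then have cc: "cinner c c / (t * cnj t) = 1 / t + 1 / cnj t"
    using t by (simp add: field_simps)
  have mult: "reflection_onto a b *v x = (cinner x c / t) *s c - x" for x
    by (simp add: reflection_onto_mult c_def t_def)
  have "cinner (reflection_onto a b *v x) (reflection_onto a b *v y) = cinner x y" for x y
  proof -
    have "cinner (reflection_onto a b *v x) (reflection_onto a b *v y) =
        cinner x c * cnj (cinner y c) * (cinner c c / (t * cnj t) - (1 / t + 1 / cnj t)) + cinner x y"
      unfolding mult cinner_simps using cinner_commute[of c y] t by (simp add: field_simps)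
    then show ?thesis
      by (simp add: cc)
  qed
  then show "unitary_matrix (reflection_onto a b)"
    by (simp add: unitary_matrix_iff_isometry)
  have "cinner a c = t"
    using ab by (simp add: c_def t_def cinner_simps cinner_self)
  then show "reflection_onto a b *v a = b"
    using t by (simp add: mult c_def)
qed

lemma norm_add_sq_cinner: "of_real ((norm (x + y))\<^sup>2) = cinner x x + cinner x y + cnj (cinner x y) + cinner y y"
  unfolding cinner_self[symmetric] using cinner_commute[of y x] by (simp add: cinner_simps)

text \<open>An equality case of Cauchy-Schwarz, read off from |a + b|^2 = 0. It shows that only
  antipodal unit vectors are excluded in \<open>reflection_onto\<close>.\<close>

lemma cinner_eq_minus_one:
  assumes "norm a = 1" "norm b = 1" "cinner a b = - 1"
  shows "b = - a"
proof -
  have "of_real ((norm (a + b))\<^sup>2) = (0 :: complex)"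
    using assms norm_add_sq_cinner[of a b] by (simp add: cinner_self)
  then have "a + b = 0"
    by simp
  then show ?thesis
    by (simp add: add_eq_0_iff)
qed

lemma unitary_matrix_transitive:
  assumes "norm a = 1" "norm b = 1"
  obtains W :: "complex ^ 'm ^ 'm" where "unitary_matrix W" "W *v a = b"
proof (cases "cinner a b = - 1")
  case True
  let ?W = "(\<chi> i j. if i = j then - 1 else 0) :: complex ^ 'm ^ 'm"
  have W: "?W *v x = - x" for x
    by (simp add: vec_eq_iff matrix_vector_mult_def if_distrib[of "\<lambda>a. a * b" for b] cong: if_cong)
  have "cinner (- x) (- y) = cinner x y" for x y :: "complex ^ 'm"
    by (simp add: cinner_def)
  then have "unitary_matrix ?W"
    by (simp add: unitary_matrix_iff_isometry W)
  moreover have "?W *v a = b"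
    using cinner_eq_minus_one[OF assms True] W by simp
  ultimately show thesis
    by (rule that)
next
  case False
  then show thesis
    using that reflection_onto[OF assms False] by blast
qed

lemma continuous_on_cinner [continuous_intros]:
  assumes "continuous_on S f" "continuous_on S g"
  shows "continuous_on S (\<lambda>z. cinner (f z) (g z))"
  unfolding cinner_def using assms by (intro continuous_intros)

text \<open>
  Along each radius of the disc, \<open>u\<close> is followed by finitely many reflections; uniform continuity
  makes a common number of steps work for all radii.
\<close>

lemma continuous_unitary_frame:
  fixes u :: "complex \<Rightarrow> complex ^ 'm"
  assumes cont: "continuous_on (cball 0 1) u" and norm_u: "\<And>z. z \<in> cball 0 1 \<Longrightarrow> norm (u z) = 1"
    and e: "norm e = 1"
  obtains V where "continuous_on (cball 0 1) V" "\<And>z. z \<in> cball 0 1 \<Longrightarrow> unitary_matrix (V z)"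
    "\<And>z. z \<in> cball 0 1 \<Longrightarrow> V z *v e = u z"
proof -
  have "uniformly_continuous_on (cball 0 1) u"
    by (rule compact_uniformly_continuous[OF cont compact_cball])
  then obtain d where d: "d > 0"
      "\<And>x y. x \<in> cball 0 1 \<Longrightarrow> y \<in> cball 0 1 \<Longrightarrow> dist y x < d \<Longrightarrow> dist (u y) (u x) < 2"
    unfolding uniformly_continuous_on_def by (metis zero_less_numeral)
  obtain N :: nat where N: "N > 0" "1 / real N < d"
    using d(1) by (metis nat_approx_posE zero_less_Suc of_nat_Suc)
  \<comment> \<open>The point at the fraction k/N of the radius through \<open>z\<close>. At
    \<open>k = 0\<close> the value of \<open>u\<close> is the constant \<open>u 0\<close>, for which
    a constant frame suffices; at \<open>k = N\<close> it is \<open>u z\<close>.\<close>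
  define s where "s k z = of_real (real k / real N) * z" for k and z :: complex
  have s_in: "s k z \<in> cball 0 1" if "k \<le> N" "z \<in> cball 0 1" for k z
    using that N(1) mult_mono[of "real k / real N" 1 "norm z" 1] by (simp add: s_def norm_mult norm_divide)
  have cont_s: "continuous_on (cball 0 1) (\<lambda>z. u (s k z))" if "k \<le> N" for k
    by (rule continuous_on_compose2[OF cont]) (use s_in[OF that] N(1) in \<open>auto simp: s_def intro!: continuous_intros\<close>)
  have "\<exists>V. continuous_on (cball 0 1) V \<and> (\<forall>z\<in>cball 0 1. unitary_matrix (V z) \<and> V z *v e = u (s k z))"
    if "k \<le> N" for k
    using that
  proof (induction k)
    case 0
    have "norm (u 0) = 1"
      using norm_u[of 0] by simp
    then obtain W where "unitary_matrix W" "W *v e = u 0"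
      using unitary_matrix_transitive[OF e] by metis
    then show ?case
      by (intro exI[of _ "\<lambda>z. W"]) (simp add: s_def)
  next
    case (Suc k)
    then obtain V where V: "continuous_on (cball 0 1) V"
        "\<forall>z\<in>cball 0 1. unitary_matrix (V z) \<and> V z *v e = u (s k z)"
      by auto
    let ?R = "\<lambda>z. reflection_onto (u (s k z)) (u (s (Suc k) z))"
    \<comment> \<open>One step moves \<open>u\<close> by less than 2, whereas antipodal unit vectors
      are at distance exactly 2; this is why 2 was chosen in the uniform continuity bound.\<close>
    have ne: "cinner (u (s k z)) (u (s (Suc k) z)) \<noteq> - 1" if z: "z \<in> cball 0 1" for z
    proof
      assume "cinner (u (s k z)) (u (s (Suc k) z)) = - 1"
      then have eq: "u (s (Suc k) z) = - u (s k z)"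
        using s_in Suc.prems z norm_u by (intro cinner_eq_minus_one) auto
      have "s (Suc k) z - s k z = of_real (1 / real N) * z"
        by (simp add: s_def add_divide_distrib algebra_simps)
      then have "dist (s (Suc k) z) (s k z) = norm z / real N"
        by (simp add: dist_norm norm_divide)
      also have "\<dots> \<le> 1 / real N"
        using z by (simp add: divide_right_mono)
      finally have "dist (u (s (Suc k) z)) (u (s k z)) < 2"
        using s_in Suc.prems z N by (intro d(2)) auto
      moreover have "dist (u (s (Suc k) z)) (u (s k z)) = 2"
      proof -
        have "u (s (Suc k) z) - u (s k z) = (-2) *\<^sub>R u (s k z)"
          unfolding eq scaleR_minus_left scaleR_2 by simp
        then show ?thesis
          using norm_u[OF s_in[of k z]] Suc.prems z by (simp add: dist_norm)
      qed
      ultimately show False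
        by simp
    qed
    show ?case
    proof (intro exI[of _ "\<lambda>z. ?R z ** V z"] conjI ballI)
      have "continuous_on (cball 0 1) ?R"
      proof -
        have nz: "1 + cinner (u (s k z)) (u (s (Suc k) z)) \<noteq> 0" if "z \<in> cball 0 1" for z
          using ne[OF that] by (simp add: add_eq_0_iff)
        show ?thesis
          unfolding reflection_onto_def
          using cont_s[of k] cont_s[of "Suc k"] Suc.prems nz
          by (intro continuous_on_vec_lambda continuous_on_diff continuous_on_divide continuous_on_mult continuous_on_cnj
              continuous_on_component continuous_on_add continuous_on_const continuous_on_cinner) auto
      qed
      then show "continuous_on (cball 0 1) (\<lambda>z. ?R z ** V z)"
        unfolding matrix_matrix_mult_def using V(1)
        by (intro continuous_on_vec_lambda continuous_on_sum continuous_on_mult continuous_on_component)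
      fix z :: complex assume z: "z \<in> cball 0 1"
      have R: "unitary_matrix (?R z)" "?R z *v u (s k z) = u (s (Suc k) z)"
        using reflection_onto[OF _ _ ne[OF z]] norm_u s_in z Suc.prems by auto
      then show "unitary_matrix (?R z ** V z)" "?R z ** V z *v e = u (s (Suc k) z)"
        using V(2) z by (auto simp: unitary_matrix_mult simp flip: matrix_vector_mul_assoc)
    qed
  qed
  from this[of N] show thesis
    using that N(1) by (auto simp: s_def)
qed

section \<open>The determinant of a matrix that fixes a basis vector\<close>

lemma sign_map_option:
  fixes q :: "'n::finite \<Rightarrow> 'n"
  assumes "q permutes UNIV"
  shows "sign (map_option q) = sign q"
proof -
  have "swapidseq n (map_option q)" if "swapidseq n q" for n and q :: "'n \<Rightarrow> 'n"
    using that
  proof induction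
    case id
    show ?case
      using swapidseq.id by (metis option.map_id0)
  next
    case (comp_Suc n p a b)
    have eq: "map_option (Transposition.transpose a b \<circ> p) = Transposition.transpose (Some a) (Some b) \<circ> map_option p"
    proof
      fix x
      show "map_option (Transposition.transpose a b \<circ> p) x = (Transposition.transpose (Some a) (Some b) \<circ> map_option p) x"
        by (cases x) (auto simp: Transposition.transpose_def)
    qed
    show ?case
      unfolding eq by (rule swapidseq.comp_Suc[OF comp_Suc.IH]) (use comp_Suc.hyps in simp)
  qed
  moreover obtain n where "swapidseq n q"
    using assms permutation_permutes permutation_def by (metis finite_class.finite_UNIV)
  ultimately show ?thesis
    using evenperm_unique by (metis sign_def)
qed

text \<open>Expansion along column \<open>None\<close>, done on the Leibniz sum because the two
  determinants have different index types. A permutation that moves \<open>None\<close> sends some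
  \<open>Some b\<close> to \<open>None\<close> and meets a zero entry; those that fix
  \<open>None\<close> are the maps \<open>map_option q\<close>.\<close>

lemma det_option_block:
  fixes B :: "'a::comm_ring_1 ^ ('n::finite option) ^ ('n option)"
  assumes "B $ None $ None = 1" "\<And>i. B $ Some i $ None = 0"
  shows "det B = det (\<chi> i j. B $ Some i $ Some j)"
proof -
  let ?f = "\<lambda>p. of_int (sign p) * (\<Prod>i\<in>UNIV. B $ i $ p i)"
  let ?P = "{q :: 'n \<Rightarrow> 'n. q permutes UNIV}"
  have inj_permutes: "p permutes UNIV" if "inj p" for p :: "'c::finite \<Rightarrow> 'c"
    using that by (intro bij_imp_permutes) (auto simp: bij_def dest: finite_UNIV_inj_surj[OF finite])
  have "det B = sum ?f (map_option ` ?P)"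
    unfolding det_def
  proof (rule sum.mono_neutral_right)
    have "map_option q permutes UNIV" if "q permutes UNIV" for q :: "'n \<Rightarrow> 'n"
      by (rule inj_permutes[OF option.inj_map[OF permutes_inj[OF that]]])
    then show "map_option ` ?P \<subseteq> {p. p permutes UNIV}"
      by blast
    show "\<forall>p\<in>{p. p permutes UNIV} - map_option ` ?P. ?f p = 0"
    proof
      fix p assume p: "p \<in> {p. p permutes UNIV} - map_option ` ?P"
      then have bij: "bij p"
        using permutes_bij by blast
      have "p None \<noteq> None"
      proof
        assume None: "p None = None"
        have Some: "p (Some i) = Some (the (p (Some i)))" for i
          using bij None by (metis bij_is_inj injD option.collapse option.distinct(1))
        have "p = map_option (\<lambda>i. the (p (Some i)))"
        proof
          fix x show "p x = map_option (\<lambda>i. the (p (Some i))) x"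
            using None Some by (cases x) auto
        qed
        moreover have "inj (\<lambda>i. the (p (Some i)))"
          using bij Some by (metis (mono_tags, lifting) bij_is_inj injD injI option.inject)
        then have "(\<lambda>i. the (p (Some i))) permutes UNIV"
          by (rule inj_permutes)
        ultimately show False
          using p by blast
      qed
      moreover obtain k where "p k = None"
        using bij by (metis bij_pointE)
      ultimately obtain b where "p (Some b) = None"
        by (metis option.exhaust)
      then have "B $ Some b $ p (Some b) = 0"
        using assms(2) by simp
      then have "(\<Prod>i\<in>UNIV. B $ i $ p i) = 0"
        by (intro prod_zero) auto
      then show "?f p = 0"
        by simp
    qed
  qed simp
  also have "\<dots> = sum (?f \<circ> map_option) ?P"
    by (rule sum.reindex, rule inj_onI, rule ext) (metis option.inject option.map(2))
  also have "\<dots> = det (\<chi> i j. B $ Some i $ Some j)"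
    unfolding det_def
  proof (rule sum.cong[OF refl])
    fix q assume "q \<in> ?P"
    moreover have "(\<Prod>i\<in>UNIV. B $ i $ map_option q i) = (\<Prod>i\<in>UNIV. B $ Some i $ Some (q i))"
      by (simp add: UNIV_option_conv prod.reindex assms(1))
    ultimately show "(?f \<circ> map_option) q =
        of_int (sign q) * (\<Prod>i\<in>UNIV. (\<chi> i j. B $ Some i $ Some j) $ i $ q i)"
      by (simp add: sign_map_option)
  qed
  finally show ?thesis .
qed

section \<open>Tangent vectors of projective space and of the Clifford torus\<close>
text \<open>With \<open>vec_tail\<close> as inverse, this identifies C^n isometrically with the
  orthogonal complement of \<open>axis None 1\<close>.\<close>

definition zero_cons :: "complex ^ 'n \<Rightarrow> complex ^ ('n::finite option)" where
  "zero_cons y = (\<chi> i. case i of None \<Rightarrow> 0 | Some b \<Rightarrow> y $ b)"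

definition vec_tail :: "complex ^ ('n::finite option) \<Rightarrow> complex ^ 'n" where
  "vec_tail x = (\<chi> b. x $ Some b)"

lemma zero_cons_nth [simp]: "zero_cons y $ None = 0" "zero_cons y $ Some b = y $ b"
  by (simp_all add: zero_cons_def)

lemma vec_tail_nth [simp]: "vec_tail x $ b = x $ Some b"
  by (simp add: vec_tail_def)

lemma vec_tail_zero_cons [simp]: "vec_tail (zero_cons y) = y"
  by (simp add: vec_eq_iff)

lemma zero_cons_vec_tail: "x $ None = 0 \<Longrightarrow> zero_cons (vec_tail x) = x"
  unfolding vec_eq_iff by (metis option.exhaust vec_tail_nth zero_cons_nth)

lemma vec_tail_linear: "vec_tail (x + y) = vec_tail x + vec_tail y" "vec_tail (c *s x) = c *s vec_tail x"
  by (simp_all add: vec_eq_iff)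

lemma zero_cons_linear: "zero_cons (x + y) = zero_cons x + zero_cons y" "zero_cons (c *s x) = c *s zero_cons x"
  by (simp_all add: vec_eq_iff zero_cons_def split: option.split)

lemma sum_UNIV_option: "(\<Sum>i\<in>UNIV. f i) = f None + (\<Sum>b\<in>UNIV. f (Some b))"
  for f :: "'n::finite option \<Rightarrow> 'a::comm_monoid_add"
  by (simp add: UNIV_option_conv sum.reindex)

lemma cinner_zero_cons: "cinner (zero_cons x) (zero_cons y) = cinner x y"
  by (simp add: cinner_def sum_UNIV_option)

lemma cinner_vec_tail: "x $ None = 0 \<Longrightarrow> cinner (vec_tail x) (vec_tail y) = cinner x y"
  by (simp add: cinner_def sum_UNIV_option)

text \<open>For a unit vector \<open>u\<close> and \<open>y\<close> orthogonal to it, this is the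
  tangent vector at the line of \<open>u\<close> that sends \<open>u\<close> to
  \<open>y\<close>.\<close>

definition outer_product :: "complex ^ 'm \<Rightarrow> complex ^ 'm \<Rightarrow> complex ^ 'm ^ 'm" where
  "outer_product y u = (\<chi> i j. y $ i * cnj (u $ j))"

lemma outer_product_mult: "outer_product y u *v v = cinner v u *s y"
  by (simp add: outer_product_def matrix_vector_mult_def cinner_def vec_eq_iff sum_distrib_left mult_ac)

lemma outer_product_linear:
  "outer_product (x + y) u = outer_product x u + outer_product y u"
  "outer_product (c *s x) u = (\<chi> i. c *s outer_product x u $ i)"
  by (simp_all add: outer_product_def vec_eq_iff algebra_simps)

lemma fubini_study_outer_product: "fubini_study (outer_product x u) (outer_product y u) = cinner x y * cinner u u"
proof -
  have "cinner (outer_product x u $ i) (outer_product y u $ i) = x $ i * cnj (y $ i) * cinner u u" for i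
    by (simp add: cinner_def outer_product_def sum_distrib_left mult_ac)
  then show ?thesis
    by (simp add: fubini_study_def cinner_def flip: sum_distrib_right)
qed

lemma outer_product_in_tangent_space:
  assumes u: "norm u = 1" and y: "cinner y u = 0"
  shows "outer_product y u \<in> tangent_space (hpoint u)" "outer_product y u *v u = y"
proof -
  have "u \<noteq> 0" using u by auto
  then show "outer_product y u \<in> tangent_space (hpoint u)"
    using y by (simp add: tangent_space_hpoint outer_product_mult cinner_smult_left)
  show "outer_product y u *v u = y"
    using u by (simp add: outer_product_mult cinner_self)
qed

text \<open>A tangent vector kills the complement of the line, so splitting \<open>v\<close> into
  its part along \<open>u\<close> and a rest orthogonal to \<open>u\<close> leaves only the value at
  \<open>u\<close>.\<close>

lemma tangent_space_hpoint_outer_product: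
  assumes u: "norm u = 1" and X: "X \<in> tangent_space (hpoint u)"
  shows "cinner (X *v u) u = 0" "X = outer_product (X *v u) u"
proof -
  have "u \<noteq> 0" using u by auto
  then have X': "cinner (X *v v) u = 0" "cinner v u = 0 \<Longrightarrow> X *v v = 0" for v
    using X by (auto simp: tangent_space_hpoint)
  then show "cinner (X *v u) u = 0"
    by blast
  have "X *v v = outer_product (X *v u) u *v v" for v
  proof -
    have "cinner (v - cinner v u *s u) u = 0"
      using u by (simp add: cinner_simps cinner_self)
    then have "X *v (v - cinner v u *s u) = 0"
      by (rule X')
    then show ?thesis
      by (simp add: matrix_vector_mult_diff_distrib vector_scalar_commute outer_product_mult)
  qed
  then show "X = outer_product (X *v u) u"
    using matrix_eq by blast
qed

lemma has_vector_derivative_vec_lambda: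
  fixes f :: "'m::finite \<Rightarrow> real \<Rightarrow> complex"
  assumes "\<And>i. (f i has_vector_derivative f' i) (at x)"
  shows "((\<lambda>t. \<chi> i. f i t) has_vector_derivative (\<chi> i. f' i)) (at x)"
  unfolding has_vector_derivative_def
proof (subst has_derivative_componentwise_within, rule ballI)
  fix b :: "complex ^ 'm" assume "b \<in> Basis"
  then obtain i c where "b = axis i c"
    by (auto simp: Basis_vec_def)
  then show "((\<lambda>t. (\<chi> i. f i t) \<bullet> b) has_derivative (\<lambda>t. (t *\<^sub>R (\<chi> i. f' i)) \<bullet> b)) (at x)"
    using assms[of i] has_derivative_inner_left[of "f i" "\<lambda>t. t *\<^sub>R f' i" "at x" c]
    by (simp add: inner_axis has_vector_derivative_def)
qed

text \<open>Forwards, differentiating the equality of the squared moduli along a curve shows that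
  the logarithmic derivatives \<open>g j\<close> share one real part; orthogonality of
  \<open>X *v u\<close> to \<open>u\<close> forces this to be the real part of \<open>c\<close>.
  Backwards, each coordinate is rotated with constant speed \<open>s j\<close>. That the speeds sum
  to 0 is contained in \<open>X \<in> tangent_space (hpoint u)\<close>.\<close>

lemma tangent_space_of_clifford_torus:
  fixes u :: "complex ^ ('n::finite option)"
  assumes norm_u: "norm u = 1" and eq: "\<And>i j. norm (u $ i) = norm (u $ j)"
  shows "X \<in> tangent_space_of clifford_torus (hpoint u) \<longleftrightarrow>
    X \<in> tangent_space (hpoint u) \<and> (\<exists>s :: 'n option \<Rightarrow> real. \<forall>j. (X *v u) $ j = \<i> * s j * u $ j)"
proof
  have u: "u \<noteq> 0" using norm_u by auto
  have nz: "u $ j \<noteq> 0" for j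
    using clifford_torus_coord_nonzero[OF u] eq by blast
  show "X \<in> tangent_space (hpoint u) \<and> (\<exists>s :: 'n option \<Rightarrow> real. \<forall>j. (X *v u) $ j = \<i> * s j * u $ j)"
    if XL: "X \<in> tangent_space_of clifford_torus (hpoint u)"
  proof
    show X: "X \<in> tangent_space (hpoint u)"
      using XL by (simp add: tangent_space_of_def)
    obtain \<gamma> where C1: "\<gamma> C1_differentiable_on UNIV"
        and \<gamma>: "\<forall>t. \<gamma> t \<noteq> 0 \<and> hpoint (\<gamma> t) \<in> clifford_torus" "hpoint (\<gamma> 0) = hpoint u"
        and "\<exists>c. vector_derivative \<gamma> (at 0) = X *v \<gamma> 0 + c *s \<gamma> 0"
      using XL unfolding tangent_space_of_def by blast
    then obtain c where c: "vector_derivative \<gamma> (at 0) = X *v \<gamma> 0 + c *s \<gamma> 0"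
      by blast
    define d where "d = vector_derivative \<gamma> (at 0)"
    have d: "(\<gamma> has_vector_derivative d) (at 0)"
      using C1 unfolding C1_differentiable_on_def d_def by (metis UNIV_I vector_derivative_at)
    obtain l where l: "l \<noteq> 0" "\<gamma> 0 = l *s u"
      using hpoint_eq_iff[of u "\<gamma> 0"] u \<gamma> by auto
    define g where "g j = d $ j / \<gamma> 0 $ j" for j
    have nz0: "\<gamma> 0 $ j \<noteq> 0" for j
      using l nz by simp
    define r where "r = (norm (\<gamma> 0 $ None))\<^sup>2"
    have r: "r \<noteq> 0"
      using nz0 by (simp add: r_def)
    have norm_eq: "norm (\<gamma> t $ j) = norm (\<gamma> t $ None)" for t j
      using \<gamma>(1) hpoint_in_clifford_torus by blast
    have Re_g: "Re (g j) = Re (g None)" for j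
    proof -
      have deriv: "((\<lambda>t. \<gamma> t $ k * cnj (\<gamma> t $ k)) has_vector_derivative of_real (2 * Re (g k) * r)) (at 0)" for k
      proof -
        have "((\<lambda>t. \<gamma> t $ k) has_vector_derivative d $ k) (at 0)"
          by (rule bounded_linear.has_vector_derivative[OF bounded_linear_vec_nth d])
        moreover from this have "((\<lambda>t. cnj (\<gamma> t $ k)) has_vector_derivative cnj (d $ k)) (at 0)"
          by (rule bounded_linear.has_vector_derivative[OF bounded_linear_cnj])
        ultimately have "((\<lambda>t. \<gamma> t $ k * cnj (\<gamma> t $ k)) has_vector_derivative
            (\<gamma> 0 $ k * cnj (d $ k) + d $ k * cnj (\<gamma> 0 $ k))) (at 0)"
          by (rule has_vector_derivative_mult)
        moreover have "\<gamma> 0 $ k * cnj (d $ k) + d $ k * cnj (\<gamma> 0 $ k) =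
            (g k + cnj (g k)) * (\<gamma> 0 $ k * cnj (\<gamma> 0 $ k))"
          using nz0 by (simp add: g_def field_simps)
        moreover have "\<gamma> 0 $ k * cnj (\<gamma> 0 $ k) = of_real r"
          unfolding r_def norm_eq[of 0 k, symmetric] by (rule complex_norm_square[symmetric])
        ultimately show ?thesis
          by (simp add: complex_add_cnj)
      qed
      have eq_fun: "(\<lambda>t. \<gamma> t $ j * cnj (\<gamma> t $ j)) = (\<lambda>t. \<gamma> t $ None * cnj (\<gamma> t $ None))"
        by (simp only: complex_norm_square[symmetric] norm_eq[of _ j])
      have "complex_of_real (2 * Re (g j) * r) = of_real (2 * Re (g None) * r)"
        by (rule vector_derivative_unique_at[OF deriv[of j, unfolded eq_fun] deriv[of None]])
      then show ?thesis
        using r unfolding of_real_eq_iff by simp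
    qed
    have Xu: "(X *v u) $ j = (g j - c) * u $ j" for j
    proof -
      have "g j * (l * u $ j) = l * (X *v u) $ j + c * (l * u $ j)"
        using c nz0[of j] l unfolding g_def d_def by (simp add: vector_scalar_commute)
      then have "l * (X *v u) $ j = l * ((g j - c) * u $ j)"
        by (simp add: algebra_simps)
      then show ?thesis
        using l(1) by simp
    qed
    define \<kappa> where "\<kappa> = complex_of_real ((norm (u $ None))\<^sup>2)"
    have \<kappa>: "\<kappa> \<noteq> 0" "u $ j * cnj (u $ j) = \<kappa>" for j
      using nz[of None] eq[of j None] by (auto simp: \<kappa>_def simp flip: complex_norm_square)
    \<comment> \<open>All coordinates of \<open>u\<close> have the same squared modulus \<kappa>, so
      orthogonality to \<open>u\<close> becomes a vanishing sum.\<close>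
    have "(\<Sum>j\<in>UNIV. g j - c) * \<kappa> = 0"
      using tangent_space_hpoint_outer_product(1)[OF norm_u X]
      unfolding cinner_def Xu by (simp add: mult.assoc \<kappa>(2) flip: sum_distrib_right)
    then have "(\<Sum>j\<in>UNIV. g j - c) = 0"
      using \<kappa>(1) by simp
    then have "(\<Sum>j\<in>UNIV. Re (g j - c)) = 0"
      unfolding Re_sum[symmetric] by simp
    moreover have "(\<Sum>j\<in>UNIV. Re (g j - c)) = (\<Sum>j\<in>(UNIV :: 'n option set). Re (g None) - Re c)"
    proof (rule sum.cong[OF refl])
      show "Re (g j - c) = Re (g None) - Re c" for j
        using Re_g[of j] by simp
    qed
    ultimately have "(\<Sum>j\<in>(UNIV :: 'n option set). Re (g None) - Re c) = 0"
      by simp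
    then have "Re (g None) - Re c = 0"
      unfolding sum_constant by simp
    then have "g j - c = \<i> * Im (g j - c)" for j
      using Re_g[of j] by (simp add: complex_eq_iff)
    with Xu show "\<exists>s :: 'n option \<Rightarrow> real. \<forall>j. (X *v u) $ j = \<i> * s j * u $ j"
      by (intro exI[of _ "\<lambda>j. Im (g j - c)"]) metis
  qed
  show "X \<in> tangent_space_of clifford_torus (hpoint u)"
    if X: "X \<in> tangent_space (hpoint u) \<and> (\<exists>s :: 'n option \<Rightarrow> real. \<forall>j. (X *v u) $ j = \<i> * s j * u $ j)"
  proof -
    obtain s :: "'n option \<Rightarrow> real" where s: "\<And>j. (X *v u) $ j = \<i> * s j * u $ j"
      using X by blast
    define \<gamma> :: "real \<Rightarrow> complex ^ ('n option)" where "\<gamma> t = (\<chi> j. u $ j * exp (\<i> * s j * t))" for t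
    have exp_deriv: "((\<lambda>z. a * exp (c * z)) has_field_derivative a * (exp (c * x) * c)) (at x)" for a c x :: complex
      by (rule derivative_eq_intros refl | simp)+
    define d :: "real \<Rightarrow> complex ^ ('n option)" where "d t = (\<chi> j. u $ j * (exp (\<i> * s j * t) * (\<i> * s j)))" for t
    have deriv: "(\<gamma> has_vector_derivative d t) (at t)" for t
      unfolding \<gamma>_def d_def
    proof (rule has_vector_derivative_vec_lambda)
      fix j
      show "((\<lambda>t. u $ j * exp (\<i> * s j * of_real t)) has_vector_derivative
          u $ j * (exp (\<i> * s j * of_real t) * (\<i> * s j))) (at t)"
        by (rule has_vector_derivative_real_field[OF exp_deriv])
    qed
    have "continuous_on UNIV d"
      unfolding d_def
      by (intro continuous_on_vec_lambda continuous_on_mult continuous_on_exp continuous_on_of_real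
          continuous_on_const continuous_on_id)
    with deriv have "\<gamma> C1_differentiable_on UNIV"
      unfolding C1_differentiable_on_def by blast
    moreover have nz: "\<gamma> t \<noteq> 0" for t
      using nz[of None] unfolding \<gamma>_def by (auto simp: vec_eq_iff)
    moreover have "hpoint (\<gamma> t) \<in> clifford_torus" for t
      using hpoint_in_clifford_torus[OF nz] eq by (simp add: \<gamma>_def norm_mult)
    moreover have "\<gamma> 0 = u"
      by (simp add: \<gamma>_def vec_eq_iff)
    \<comment> \<open>The multiple of \<open>u\<close> allowed in \<open>tangent_space_of\<close> is
      taken to be 0: the initial velocity is \<open>X *v u\<close> itself.\<close>
    moreover have "vector_derivative \<gamma> (at 0) = X *v u + 0 *s u"
      using vector_derivative_at[OF deriv[of 0]] s by (simp add: d_def vec_eq_iff mult_ac)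
    ultimately show ?thesis
      unfolding tangent_space_of_def using X by auto
  qed
qed

section \<open>Hermitian trivializations\<close>
text \<open>Intended for unitary \<open>V\<close> with column \<open>None\<close> equal to
  \<open>u\<close>: the other columns are an orthonormal basis of the complement of
  \<open>u\<close>, in which \<open>X *v u\<close> is expanded. The inverse is
  \<open>frame_tangent\<close>.\<close>

definition frame_coords :: "complex ^ ('n::finite option) ^ ('n option) \<Rightarrow> complex ^ ('n option) \<Rightarrow>
    complex ^ ('n option) ^ ('n option) \<Rightarrow> complex ^ 'n" where
  "frame_coords V u X = vec_tail (conj_transpose V *v (X *v u))"

definition frame_tangent :: "complex ^ ('n::finite option) ^ ('n option) \<Rightarrow> complex ^ ('n option) \<Rightarrow>
    complex ^ 'n \<Rightarrow> complex ^ ('n option) ^ ('n option)" where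
  "frame_tangent V u y = outer_product (V *v zero_cons y) u"

lemma frame_tangent_linear:
  "frame_tangent V u (x + y) = frame_tangent V u x + frame_tangent V u y"
  "frame_tangent V u (c *s x) = (\<chi> i. c *s frame_tangent V u x $ i)"
  by (simp_all only: frame_tangent_def zero_cons_linear matrix_vector_right_distrib
      vector_scalar_commute outer_product_linear)

locale tangent_frame =
  fixes V :: "complex ^ ('n::finite option) ^ ('n option)" and u :: "complex ^ ('n option)"
  assumes unitary: "unitary_matrix V" and V_axis: "V *v axis None 1 = u" and norm_u: "norm u = 1"
begin

lemma conj_transpose_None:
  assumes "cinner x u = 0"
  shows "(conj_transpose V *v x) $ None = 0"
proof -
  have "cinner (conj_transpose V *v x) (axis None 1) = cinner x u"
    using cinner_mult_left[of "conj_transpose V" x] V_axis by simp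
  then show ?thesis
    using assms by (simp add: cinner_axis_right)
qed

lemma cinner_frame: "cinner (V *v zero_cons y) u = 0"
proof -
  have "cinner (V *v zero_cons y) u = cinner (zero_cons y) (axis None 1)"
    using unitary unfolding V_axis[symmetric] by (simp add: unitary_matrix_iff_isometry)
  then show ?thesis
    by (simp add: cinner_axis_right)
qed

lemma frame_tangent:
  "frame_tangent V u y \<in> tangent_space (hpoint u)" "frame_tangent V u y *v u = V *v zero_cons y"
  unfolding frame_tangent_def
  using outer_product_in_tangent_space[OF norm_u cinner_frame] by blast+

lemma frame_coords_tangent [simp]: "frame_coords V u (frame_tangent V u y) = y"
  using unitary by (simp add: frame_coords_def frame_tangent(2) unitary_matrix_cancel)

lemma frame_tangent_coords:
  assumes "X \<in> tangent_space (hpoint u)"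
  shows "frame_tangent V u (frame_coords V u X) = X"
proof -
  note X = tangent_space_hpoint_outer_product[OF norm_u assms]
  have "V *v zero_cons (frame_coords V u X) = X *v u"
    using unitary by (simp add: frame_coords_def zero_cons_vec_tail conj_transpose_None[OF X(1)] unitary_matrix_cancel)
  then show ?thesis
    using X(2) by (simp add: frame_tangent_def)
qed

lemma frame_coords_linear:
  "frame_coords V u (X + Y) = frame_coords V u X + frame_coords V u Y"
  "frame_coords V u (\<chi> i. c *s X $ i) = c *s frame_coords V u X"
proof -
  have "(\<chi> i. c *s X $ i) *v u = c *s (X *v u)"
    by (simp add: vec_eq_iff matrix_vector_mult_def sum_distrib_left mult_ac)
  then show "frame_coords V u (\<chi> i. c *s X $ i) = c *s frame_coords V u X"
    by (simp add: frame_coords_def vector_scalar_commute vec_tail_linear)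
qed (simp add: frame_coords_def matrix_vector_mult_add_rdistrib matrix_vector_right_distrib vec_tail_linear)

lemma fubini_study_frame_tangent:
  "fubini_study (frame_tangent V u x) (frame_tangent V u y) = cinner x y"
  using unitary norm_u
  by (simp add: frame_tangent_def fubini_study_outer_product cinner_self[of u] unitary_matrix_iff_isometry cinner_zero_cons)

lemma bij_betw_frame_coords: "bij_betw (frame_coords V u) (tangent_space (hpoint u)) UNIV"
  by (rule bij_betw_byWitness[where f' = "frame_tangent V u"])
     (use frame_tangent(1) frame_tangent_coords in auto)

end

lemma hermitian_trivialization_frame_coords:
  fixes w :: "complex \<Rightarrow> 'n::finite cproj"
  assumes "continuous_on (cball 0 1) V" "continuous_on (cball 0 1) u"
    and frame: "\<And>z. z \<in> cball 0 1 \<Longrightarrow> tangent_frame (V z) (u z)"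
    and w: "\<And>z. z \<in> cball 0 1 \<Longrightarrow> w z = hpoint (u z)"
  shows "hermitian_trivialization w (\<lambda>z. frame_coords (V z) (u z))"
  unfolding hermitian_trivialization_def
proof (intro conjI ballI allI)
  let ?S = "SIGMA z:cball 0 1. tangent_space (w z)"
  have V: "continuous_on ?S (\<lambda>p. V (fst p))" and u: "continuous_on ?S (\<lambda>p. u (fst p))"
    by (rule continuous_on_compose2[OF assms(1)], auto intro: continuous_on_fst continuous_on_id)
       (rule continuous_on_compose2[OF assms(2)], auto intro: continuous_on_fst continuous_on_id)
  show "continuous_on ?S (\<lambda>(z, X). frame_coords (V z) (u z) X)"
    unfolding case_prod_beta frame_coords_def vec_tail_def conj_transpose_def matrix_vector_mult_def
      vec_lambda_beta
    by (intro continuous_on_vec_lambda continuous_on_sum continuous_on_mult continuous_on_cnj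
        continuous_on_component V u continuous_on_snd continuous_on_id)
  fix z :: complex assume z: "z \<in> cball 0 1"
  interpret tangent_frame "V z" "u z"
    by (rule frame[OF z])
  show "bij_betw (frame_coords (V z) (u z)) (tangent_space (w z)) UNIV"
    unfolding w[OF z] by (rule bij_betw_frame_coords)
  fix X Y assume X: "X \<in> tangent_space (w z)" and Y: "Y \<in> tangent_space (w z)"
  show "frame_coords (V z) (u z) (X + Y) = frame_coords (V z) (u z) X + frame_coords (V z) (u z) Y"
    "frame_coords (V z) (u z) (\<chi> i. c *s X $ i) = c *s frame_coords (V z) (u z) X" for c
    by (rule frame_coords_linear)+
  show "cinner (frame_coords (V z) (u z) X) (frame_coords (V z) (u z) Y) = fubini_study X Y"
    using fubini_study_frame_tangent[of "frame_coords (V z) (u z) X" "frame_coords (V z) (u z) Y"]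
      frame_tangent_coords X Y w[OF z] by simp
qed

text \<open>The transition matrix is continuous on the whole disc, not only on the circle. Its
  determinant therefore has degree 0 on the boundary, which makes the index independent of the
  trivialization.\<close>

lemma hermitian_trivialization_transition:
  fixes w :: "complex \<Rightarrow> 'n::finite cproj"
  assumes cont: "continuous_on (cball 0 1) V" "continuous_on (cball 0 1) u"
    and frame: "\<And>z. z \<in> cball 0 1 \<Longrightarrow> tangent_frame (V z) (u z)"
    and w: "\<And>z. z \<in> cball 0 1 \<Longrightarrow> w z = hpoint (u z)"
    and \<Phi>: "hermitian_trivialization w \<Phi>"
  obtains Q where "continuous_on (cball 0 1) Q" "\<And>z. z \<in> cball 0 1 \<Longrightarrow> unitary_matrix (Q z)"
    "\<And>z X. z \<in> cball 0 1 \<Longrightarrow> X \<in> tangent_space (w z) \<Longrightarrow> \<Phi> z X = Q z *v frame_coords (V z) (u z) X"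
proof -
  define F where "F z y = \<Phi> z (frame_tangent (V z) (u z) y)" for z y
  define Q where "Q z = matrix (F z)" for z
  have tangent: "frame_tangent (V z) (u z) y \<in> tangent_space (w z)" if "z \<in> cball 0 1" for z y
    using tangent_frame.frame_tangent(1)[OF frame[OF that]] w[OF that] by simp
  have F: "Q z *v y = F z y" if z: "z \<in> cball 0 1" for z y
  proof -
    have "F z (x + y) = F z x + F z y" "F z (c *s x) = c *s F z x" for x y c
      using \<Phi> tangent[OF z] z unfolding F_def frame_tangent_linear hermitian_trivialization_def by blast+
    then show ?thesis
      unfolding Q_def
      by (intro matrix_works) (simp add: Vector_Spaces.linear_iff vec.vector_space_axioms)
  qed
  have iso: "cinner (F z x) (F z y) = cinner x y" if z: "z \<in> cball 0 1" for z x y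
    using \<Phi> tangent[OF z] z tangent_frame.fubini_study_frame_tangent[OF frame[OF z]]
    unfolding F_def hermitian_trivialization_def by metis
  show thesis
  proof
    show "unitary_matrix (Q z)" if "z \<in> cball 0 1" for z
      using iso that by (simp add: unitary_matrix_iff_isometry F)
    show "\<Phi> z X = Q z *v frame_coords (V z) (u z) X" if "z \<in> cball 0 1" "X \<in> tangent_space (w z)" for z X
      using that by (simp add: F F_def w tangent_frame.frame_tangent_coords[OF frame])
    \<comment> \<open>Columns of \<open>Q\<close> are images of sections with constant frame
      coordinates, so continuity along each such section is enough.\<close>
    have "continuous_on (cball 0 1) (\<lambda>z. F z y)" for y
    proof -
      have "continuous_on (cball 0 1) (\<lambda>z. frame_tangent (V z) (u z) y)"
        unfolding frame_tangent_def outer_product_def matrix_vector_mult_def vec_lambda_beta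
        by (intro continuous_on_vec_lambda continuous_on_sum continuous_on_mult continuous_on_cnj
          continuous_on_component cont continuous_on_const)
      then have 1: "continuous_on (cball 0 1) (\<lambda>z. (z, frame_tangent (V z) (u z) y))"
        by (intro continuous_on_Pair continuous_on_id)
      have 2: "continuous_on (SIGMA z:cball 0 1. tangent_space (w z)) (\<lambda>(z, X). \<Phi> z X)"
        using \<Phi> by (simp add: hermitian_trivialization_def)
      have "continuous_on (cball 0 1) (\<lambda>z. (\<lambda>(z, X). \<Phi> z X) (z, frame_tangent (V z) (u z) y))"
        by (rule continuous_on_compose2[OF 2 1]) (use tangent in auto)
      then show ?thesis
        by (simp add: F_def)
    qed
    then show "continuous_on (cball 0 1) Q"
      unfolding Q_def matrix_def by (intro continuous_on_vec_lambda continuous_on_component)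
  qed
qed

section \<open>The Lagrangian frame of the torus\<close>

lemma unitary_mult_transpose_unique:
  assumes A: "unitary_matrix A" and C: "unitary_matrix C"
    and eq: "(\<lambda>v. A *v v) ` real_vectors = (\<lambda>v. C *v v) ` real_vectors"
  shows "A ** transpose A = C ** transpose C"
proof -
  define R where "R = conj_transpose C ** A"
  have R: "unitary_matrix R"
    unfolding R_def by (intro unitary_matrix_mult unitary_matrix_conj_transpose A C)
  have "R $ i $ j \<in> \<real>" for i j
  proof -
    have "axis j 1 \<in> real_vectors"
      by (simp add: real_vectors_def axis_def)
    then obtain v where v: "v \<in> real_vectors" "A *v axis j 1 = C *v v"
      using eq by (metis (no_types, lifting) image_iff)
    have "R *v axis j 1 = conj_transpose C *v (A *v axis j 1)"
      by (simp add: R_def matrix_vector_mul_assoc)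
    also have "\<dots> = v"
      unfolding v(2) by (rule unitary_matrix_cancel(2)[OF C])
    finally show ?thesis
      using v(1) matrix_entry_eq_cinner[of R i j] by (simp add: cinner_axis_right real_vectors_def)
  qed
  \<comment> \<open>\<open>R\<close> relates two bases of the same real subspace, so it is real;
    being unitary too, it is orthogonal and drops out of \<open>A ** transpose A\<close>.\<close>
  then have "transpose R = conj_transpose R"
    by (simp add: vec_eq_iff transpose_def conj_transpose_def Reals_cnj_iff)
  then have RR: "R ** transpose R = mat 1"
    using R by (simp add: unitary_matrix_iff)
  have "A = C ** R"
    using C unfolding unitary_matrix_iff by (simp add: R_def matrix_mul_assoc)
  then have "A ** transpose A = C ** (R ** transpose R) ** transpose C"
    by (simp add: matrix_transpose_mul matrix_mul_assoc)
  then show ?thesis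
    by (simp add: RR)
qed

text \<open>The normalized all-ones vector. For a real vector of speeds, orthogonality to it is the
  condition that they sum to 0.\<close>

definition barycenter :: "complex ^ 'm" where
  "barycenter = (\<chi> i. of_real (1 / sqrt (CARD('m))))"

definition barycenter_rotation :: "complex ^ ('n::finite option) ^ ('n option)" where
  "barycenter_rotation = reflection_onto (axis None 1) barycenter"

definition scaled_diagonal :: "complex ^ 'm \<Rightarrow> complex ^ 'm ^ 'm" where
  "scaled_diagonal u = (\<chi> i j. if i = j then of_real (sqrt (CARD('m))) * u $ i else 0)"

text \<open>
  On the torus \<open>scaled_diagonal u\<close> is unitary and maps \<open>barycenter\<close> to \<open>u\<close>, and \<open>\<i>\<close> times its values at
  the real vectors orthogonal to \<open>barycenter\<close> are the tangent vectors. The rotation turns that real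
  subspace into the one spanned by the axes \<open>Some i\<close>, so in the coordinates given by \<open>V\<close> the block
  below fixes the axis \<open>None\<close>, and its other columns span the Lagrangian subspace up to \<open>\<i>\<close>.
\<close>

definition clifford_block :: "complex ^ ('n::finite option) ^ ('n option) \<Rightarrow> complex ^ ('n option) \<Rightarrow>
    complex ^ ('n option) ^ ('n option)" where
  "clifford_block V u = conj_transpose V ** scaled_diagonal u ** barycenter_rotation"

definition clifford_frame :: "complex ^ ('n::finite option) ^ ('n option) \<Rightarrow> complex ^ ('n option) \<Rightarrow>
    complex ^ 'n ^ 'n" where
  "clifford_frame V u = (\<chi> i j. \<i> * clifford_block V u $ Some i $ Some j)"

lemma norm_barycenter: "norm (barycenter :: complex ^ 'm) = 1"
  by (simp add: barycenter_def norm_vec_def L2_set_def norm_divide power_divide)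

lemma barycenter_rotation:
  "unitary_matrix (barycenter_rotation :: complex ^ ('n::finite option) ^ ('n option))"
  "barycenter_rotation *v axis None 1 = (barycenter :: complex ^ ('n::finite option))"
proof -
  have "cinner (axis None 1) (barycenter :: complex ^ ('n option)) \<noteq> - 1"
  proof
    assume "cinner (axis None 1) (barycenter :: complex ^ ('n option)) = - 1"
    then have "Re (cinner (axis None 1) (barycenter :: complex ^ ('n option))) = - 1"
      by simp
    moreover have "Re (cinner (axis None 1) (barycenter :: complex ^ ('n option))) \<ge> 0"
      unfolding cinner_axis_left by (simp add: barycenter_def)
    ultimately show False
      by simp
  qed
  moreover have "norm (axis None 1 :: complex ^ ('n option)) = 1"
    by (intro norm_Basis) (simp add: axis_in_Basis_iff)
  ultimately show "unitary_matrix (barycenter_rotation :: complex ^ ('n option) ^ ('n option))"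
    "barycenter_rotation *v axis None 1 = (barycenter :: complex ^ ('n option))"
    unfolding barycenter_rotation_def using reflection_onto norm_barycenter by blast+
qed

text \<open>Both vectors defining the reflection are real. The rotation and its inverse thus
  preserve real vectors, as a change of basis inside the Lagrangian subspace must.\<close>

lemma barycenter_rotation_real: "barycenter_rotation $ i $ j \<in> \<real>"
  unfolding barycenter_rotation_def reflection_onto_def vec_lambda_beta cinner_axis_left
  by (intro Reals_diff Reals_divide Reals_mult Reals_add) (auto simp: barycenter_def axis_def)

lemma matrix_vector_mult_real:
  fixes A :: "complex ^ 'n ^ 'm"
  assumes "\<And>i j. A $ i $ j \<in> \<real>" "\<And>j. v $ j \<in> \<real>"
  shows "(A *v v) $ i \<in> \<real>"
  unfolding matrix_vector_mult_def vec_lambda_beta by (intro sum_in_Reals Reals_mult assms)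

lemma scaled_diagonal_mult: "(scaled_diagonal u *v x) $ i = of_real (sqrt (CARD('m))) * u $ i * x $ i"
  for u :: "complex ^ 'm"
  by (simp add: scaled_diagonal_def matrix_vector_mult_def if_distrib[of "\<lambda>a. a * b" for b] cong: if_cong)

locale clifford_tangent_frame = tangent_frame V u
  for V :: "complex ^ ('n::finite option) ^ ('n option)" and u :: "complex ^ ('n option)" +
  assumes norm_eq: "norm (u $ i) = norm (u $ j)"
begin

text \<open>The n + 1 coordinates of the unit vector \<open>u\<close> have equal moduli, namely 1 /
  sqrt (n + 1); hence the normalizing factor in \<open>scaled_diagonal\<close>.\<close>

lemma cinner_coord: "u $ i * cnj (u $ i) * of_nat (CARD('n option)) = 1"
proof -
  have "1 = cinner u u"
    by (simp add: cinner_self norm_u)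
  also have "\<dots> = (\<Sum>j\<in>(UNIV :: 'n option set). u $ i * cnj (u $ i))"
    unfolding cinner_def
  proof (rule sum.cong[OF refl])
    show "u $ j * cnj (u $ j) = u $ i * cnj (u $ i)" for j
      unfolding complex_norm_square[symmetric] norm_eq[of j i] ..
  qed
  finally show ?thesis
    by (simp add: mult.commute)
qed

lemma unitary_scaled_diagonal: "unitary_matrix (scaled_diagonal u)"
proof -
  have "cinner (scaled_diagonal u *v x) (scaled_diagonal u *v y) = cinner x y" for x y
    unfolding cinner_def
  proof (rule sum.cong[OF refl])
    fix i
    have "(scaled_diagonal u *v x) $ i * cnj ((scaled_diagonal u *v y) $ i) =
        (u $ i * cnj (u $ i) * of_real (sqrt (CARD('n option)) * sqrt (CARD('n option)))) * (x $ i * cnj (y $ i))"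
      unfolding scaled_diagonal_mult of_real_mult complex_cnj_mult complex_cnj_complex_of_real by (simp only: mult_ac)
    also have "\<dots> = x $ i * cnj (y $ i)"
      using cinner_coord[of i] by simp
    finally show "(scaled_diagonal u *v x) $ i * cnj ((scaled_diagonal u *v y) $ i) = x $ i * cnj (y $ i)" .
  qed
  then show ?thesis
    by (simp add: unitary_matrix_iff_isometry)
qed

lemma scaled_diagonal_barycenter: "scaled_diagonal u *v barycenter = u"
  by (simp add: vec_eq_iff scaled_diagonal_mult barycenter_def flip: of_real_mult)

lemma unitary_clifford_block: "unitary_matrix (clifford_block V u)"
  unfolding clifford_block_def
  by (intro unitary_matrix_mult unitary_matrix_conj_transpose unitary unitary_scaled_diagonal barycenter_rotation)

text \<open>The three factors send \<open>axis None 1\<close> to \<open>barycenter\<close>, then to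
  \<open>u\<close>, then back to \<open>axis None 1\<close>. The radial direction thereby splits off
  from the block.\<close>

lemma clifford_block_axis: "clifford_block V u *v axis None 1 = axis None 1"
  using unitary_matrix_cancel(2)[OF unitary, of "axis None 1"]
  by (simp add: clifford_block_def barycenter_rotation(2) scaled_diagonal_barycenter V_axis
      flip: matrix_vector_mul_assoc)

lemma clifford_block_None: "(clifford_block V u *v zero_cons y) $ None = 0"
proof -
  have "cinner (clifford_block V u *v zero_cons y) (clifford_block V u *v axis None 1) = cinner (zero_cons y) (axis None 1)"
    using unitary_clifford_block unfolding unitary_matrix_iff_isometry by blast
  then show ?thesis
    unfolding clifford_block_axis cinner_axis_right by simp
qed

lemma clifford_frame_mult: "clifford_frame V u *v y = \<i> *s vec_tail (clifford_block V u *v zero_cons y)"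
  by (simp add: vec_eq_iff clifford_frame_def matrix_vector_mult_def sum_UNIV_option sum_distrib_left mult_ac)

lemma unitary_clifford_frame: "unitary_matrix (clifford_frame V u)"
proof -
  have "cinner (clifford_frame V u *v x) (clifford_frame V u *v y) = cinner x y" for x y
    using unitary_clifford_block
    by (simp add: clifford_frame_mult cinner_smult_left cinner_smult_right cinner_vec_tail clifford_block_None
        unitary_matrix_iff_isometry cinner_zero_cons)
  then show ?thesis
    by (simp add: unitary_matrix_iff_isometry)
qed

text \<open>As the block fixes \<open>axis None 1\<close>, its minor has the determinant of the full
  product of three matrices, all of them explicit. Only the product of the \<open>u $ i\<close> can
  carry winding: the other factors are constants or come from \<open>V\<close>, which will be
  continuous over the whole disc.\<close>

lemma det_clifford_frame:
  "det (clifford_frame V u) = \<i> ^ CARD('n) * (cnj (det V) *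
    (of_real (sqrt (CARD('n option))) ^ CARD('n option) * (\<Prod>i\<in>UNIV. u $ i)) *
    det (barycenter_rotation :: complex ^ ('n option) ^ ('n option)))"
proof -
  have col: "clifford_block V u $ i $ None = axis None 1 $ i" for i
    using clifford_block_axis by (simp add: matrix_entry_eq_cinner cinner_axis_right)
  have "clifford_frame V u = (\<chi> i. \<i> *s (\<chi> i j. clifford_block V u $ Some i $ Some j) $ i)"
    by (simp add: vec_eq_iff clifford_frame_def)
  then have "det (clifford_frame V u) = \<i> ^ CARD('n) * det (\<chi> i j. clifford_block V u $ Some i $ Some j)"
    using det_rows_mul[of "\<lambda>i. \<i>" "\<lambda>i. (\<chi> i j. clifford_block V u $ Some i $ Some j) $ i"] by (simp add: vec_lambda_eta)
  also have "det (\<chi> i j. clifford_block V u $ Some i $ Some j) = det (clifford_block V u)"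
    by (rule det_option_block[symmetric]) (simp_all add: col axis_def)
  also have "\<dots> = cnj (det V) * det (scaled_diagonal u) *
      det (barycenter_rotation :: complex ^ ('n option) ^ ('n option))"
    by (simp add: clifford_block_def det_mul det_conj_transpose)
  also have "det (scaled_diagonal u) = (\<Prod>i\<in>UNIV. of_real (sqrt (CARD('n option))) * u $ i)"
    by (subst det_diagonal) (auto simp: scaled_diagonal_def)
  finally show ?thesis
    by (simp add: prod.distrib)
qed

text \<open>Tangent vectors are \<i> times the image of a real \<open>t\<close> under
  \<open>scaled_diagonal u\<close>. This matrix is unitary and sends \<open>barycenter\<close> to
  \<open>u\<close>, so orthogonality to \<open>u\<close> means that \<open>t\<close> is orthogonal
  to \<open>barycenter\<close>, that is, that entry \<open>None\<close> vanishes after undoing the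
  rotation. The remaining entries are the real coordinates.\<close>

lemma frame_coords_clifford_torus:
  "frame_coords V u ` tangent_space_of clifford_torus (hpoint u) = (\<lambda>v. clifford_frame V u *v v) ` real_vectors"
proof (intro subset_antisym subsetI)
  let ?n = "sqrt (real (CARD('n option)))"
  let ?O = "barycenter_rotation :: complex ^ ('n option) ^ ('n option)"
  have tangent_iff: "X \<in> tangent_space_of clifford_torus (hpoint u) \<longleftrightarrow>
      X \<in> tangent_space (hpoint u) \<and> (\<exists>s :: 'n option \<Rightarrow> real. \<forall>j. (X *v u) $ j = \<i> * s j * u $ j)" for X
    by (rule tangent_space_of_clifford_torus[OF norm_u norm_eq])
  have n: "?n > 0"
    by simp
  {
    fix x assume "x \<in> frame_coords V u ` tangent_space_of clifford_torus (hpoint u)"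
    then obtain X s where X: "x = frame_coords V u X" "X \<in> tangent_space (hpoint u)"
        and s: "\<And>j. (X *v u) $ j = \<i> * of_real (s j) * u $ j"
      unfolding tangent_iff by (auto simp: image_iff Bex_def tangent_iff)
    \<comment> \<open>Division by \<open>?n\<close> compensates for the factor in
      \<open>scaled_diagonal\<close>.\<close>
    define t where "t = (\<chi> j. complex_of_real (s j / ?n)) "
    have Xu: "X *v u = \<i> *s (scaled_diagonal u *v t)"
      using n by (simp add: vec_eq_iff s scaled_diagonal_mult t_def)
    define y where "y = conj_transpose ?O *v t"
    have "y $ None = 0"
    proof -
      have "\<i> * cinner t barycenter = cinner (\<i> *s (scaled_diagonal u *v t)) (scaled_diagonal u *v barycenter)"
        using unitary_scaled_diagonal by (simp add: cinner_smult_left unitary_matrix_iff_isometry)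
      also have "\<dots> = 0"
        unfolding scaled_diagonal_barycenter Xu[symmetric]
        by (rule tangent_space_hpoint_outer_product(1)[OF norm_u X(2)])
      finally have "cinner t barycenter = 0"
        by simp
      then have "cinner y (axis None 1) = 0"
        unfolding y_def cinner_mult_left conj_transpose_conj_transpose barycenter_rotation(2) .
      then show ?thesis
        by (simp add: cinner_axis_right)
    qed
    then have "zero_cons (vec_tail y) = y"
      by (rule zero_cons_vec_tail)
    then have "?O *v zero_cons (vec_tail y) = t"
      unfolding y_def using unitary_matrix_cancel(1)[OF barycenter_rotation(1)] by simp
    then have "x = clifford_frame V u *v vec_tail y"
      unfolding clifford_frame_mult X(1) frame_coords_def Xu clifford_block_def
      by (simp add: vector_scalar_commute vec_tail_linear flip: matrix_vector_mul_assoc)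
    moreover have "conj_transpose ?O $ i $ j \<in> \<real>" for i j
    proof -
      have "?O $ j $ i \<in> \<real>"
        by (rule barycenter_rotation_real)
      then show ?thesis
        by (simp add: conj_transpose_def Reals_cnj_iff)
    qed
    then have "y $ j \<in> \<real>" for j
      unfolding y_def by (intro matrix_vector_mult_real) (simp_all add: t_def)
    then have "vec_tail y \<in> real_vectors"
      by (simp add: real_vectors_def)
    ultimately show "x \<in> (\<lambda>v. clifford_frame V u *v v) ` real_vectors"
      by blast
  }
  fix x assume "x \<in> (\<lambda>v. clifford_frame V u *v v) ` real_vectors"
  then obtain y where y: "y \<in> real_vectors" "x = clifford_frame V u *v y"
    by blast
  define t where "t = ?O *v zero_cons y"
  have "zero_cons y $ j \<in> \<real>" for j
    using y(1) by (cases j) (auto simp: real_vectors_def)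
  then have "t $ j \<in> \<real>" for j
    unfolding t_def by (intro matrix_vector_mult_real barycenter_rotation_real)
  then have "\<forall>j. \<exists>r. t $ j = of_real r"
    by (metis Reals_cases)
  then obtain r where r: "\<And>j. t $ j = of_real (r j)"
    by metis
  \<comment> \<open>The tangent vector with coordinates \<open>x\<close>; its angular speeds turn
    out to be \<open>?n * r j\<close>.\<close>
  let ?X = "frame_tangent V u x"
  have "V *v zero_cons x = \<i> *s (scaled_diagonal u *v t)"
    using zero_cons_vec_tail[OF clifford_block_None[of y]]
    unfolding y(2) clifford_frame_mult zero_cons_linear vector_scalar_commute t_def
    by (simp add: clifford_block_def unitary_matrix_cancel(1)[OF unitary] flip: matrix_vector_mul_assoc)
  then have "(?X *v u) $ j = \<i> * of_real (?n * r j) * u $ j" for j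
    unfolding frame_tangent(2) by (simp add: scaled_diagonal_mult r)
  then have "?X \<in> tangent_space_of clifford_torus (hpoint u)"
    unfolding tangent_iff using frame_tangent(1) by (intro conjI exI[of _ "\<lambda>j. ?n * r j"]) auto
  then show "x \<in> frame_coords V u ` tangent_space_of clifford_torus (hpoint u)"
    using frame_coords_tangent[of x] by (metis image_eqI)
qed

end

section \<open>The degree of the boundary loop\<close>

lemma winding_number_circle_cong:
  assumes "\<And>z. z \<in> sphere 0 1 \<Longrightarrow> f z = g z"
  shows "winding_number (f \<circ> circlepath 0 1) 0 = winding_number (g \<circ> circlepath 0 1) 0"
proof (rule winding_number_cong)
  fix t :: real
  have "circlepath 0 1 t \<in> sphere 0 1"
    by (simp add: circlepath norm_mult)
  then show "(f \<circ> circlepath 0 1) t = (g \<circ> circlepath 0 1) t"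
    using assms by simp
qed

lemma continuous_on_det:
  fixes A :: "'a::topological_space \<Rightarrow> complex ^ 'm ^ 'm"
  assumes "continuous_on S A"
  shows "continuous_on S (\<lambda>z. det (A z))"
  unfolding det_def
  by (intro continuous_on_sum continuous_on_mult continuous_on_prod continuous_on_component assms continuous_on_const)

lemma tangent_frame_exists:
  fixes u :: "complex \<Rightarrow> complex ^ ('n::finite option)"
  assumes "continuous_on (cball 0 1) u" "\<And>z. z \<in> cball 0 1 \<Longrightarrow> norm (u z) = 1"
  obtains V where "continuous_on (cball 0 1) V" "\<And>z. z \<in> cball 0 1 \<Longrightarrow> tangent_frame (V z) (u z)"
proof -
  have "norm (axis None 1 :: complex ^ ('n option)) = 1"
    by (intro norm_Basis) (simp add: axis_in_Basis_iff)
  then obtain V where "continuous_on (cball 0 1) V" "\<And>z. z \<in> cball 0 1 \<Longrightarrow> unitary_matrix (V z)"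
      "\<And>z. z \<in> cball 0 1 \<Longrightarrow> V z *v axis None 1 = u z"
    using continuous_unitary_frame[OF assms] by metis
  then show thesis
    using assms(2) by (intro that[of V]) (auto intro!: tangent_frame.intro)
qed

text \<open>\<open>A\<close> and \<open>Q ** clifford_frame V u\<close> span the same Lagrangian
  subspace, so they differ by a real orthogonal factor, invisible in
  \<open>A ** transpose A\<close>. Taking determinants produces the square.\<close>

lemma det_mult_transpose_clifford:
  fixes w :: "complex \<Rightarrow> 'n::finite cproj"
  assumes frame: "clifford_tangent_frame V u"
    and Q: "unitary_matrix Q" "\<And>X. X \<in> tangent_space (hpoint u) \<Longrightarrow> \<Psi> X = Q *v frame_coords V u X"
    and A: "unitary_matrix A"
      "\<Psi> ` tangent_space_of clifford_torus (hpoint u) = (\<lambda>v. A *v v) ` real_vectors"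
  shows "det (A ** transpose A) = (det Q * det (clifford_frame V u))\<^sup>2"
proof -
  interpret clifford_tangent_frame V u
    by (rule frame)
  let ?C = "Q ** clifford_frame V u"
  have "\<Psi> ` tangent_space_of clifford_torus (hpoint u) =
      (\<lambda>x. Q *v x) ` (frame_coords V u ` tangent_space_of clifford_torus (hpoint u))"
    unfolding image_image by (rule image_cong[OF refl]) (simp add: Q(2) tangent_space_of_def)
  also have "\<dots> = (\<lambda>v. ?C *v v) ` real_vectors"
    unfolding frame_coords_clifford_torus image_image by (simp add: matrix_vector_mul_assoc)
  finally have "(\<lambda>v. A *v v) ` real_vectors = (\<lambda>v. ?C *v v) ` real_vectors"
    using A(2) by simp
  then have "A ** transpose A = ?C ** transpose ?C"
    by (intro unitary_mult_transpose_unique A unitary_matrix_mult Q unitary_clifford_frame)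
  then show ?thesis
    by (simp add: det_mul power2_eq_square)
qed

theorem theorem9p1:
  fixes w :: "complex \<Rightarrow> 'n::finite cproj"
  assumes "holomorphic_disc clifford_torus w"
  shows "maslov_index clifford_torus w = 2 * int (\<Sum>i\<in>UNIV. total_multiplicity w i)"
proof -
  note w = assms
  obtain \<gamma> where lift: "homogeneous_lift w \<gamma>"
    by (rule homogeneous_lift_exists[OF w])
  then have \<gamma>: "continuous_on (cball 0 1) (\<lambda>z. \<gamma> z $ i)" "(\<lambda>z. \<gamma> z $ i) holomorphic_on ball 0 1"
    and nz: "z \<in> cball 0 1 \<Longrightarrow> \<gamma> z \<noteq> 0" "z \<in> cball 0 1 \<Longrightarrow> w z = hpoint (\<gamma> z)" for z i
    by (auto simp: homogeneous_lift_def)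
  have cont_\<gamma>: "continuous_on (cball 0 1) \<gamma>"
    using continuous_on_vec_lambda[of "cball 0 1" "\<lambda>i z. \<gamma> z $ i"] \<gamma>(1) by (simp add: vec_lambda_eta)
  \<comment> \<open>The normalizing factor is continuous and zero-free on the whole disc, so passing
    from \<gamma> to \<open>u\<close> changes no winding number.\<close>
  define \<rho> where "\<rho> z = complex_of_real (1 / norm (\<gamma> z))" for z
  define u where "u z = \<rho> z *s \<gamma> z" for z
  have \<rho>: "continuous_on (cball 0 1) \<rho>" "\<forall>z\<in>cball 0 1. \<rho> z \<noteq> 0"
    unfolding \<rho>_def
    using nz(1) by (auto intro!: continuous_on_of_real continuous_on_divide continuous_on_const continuous_on_norm cont_\<gamma>)
  have cont_u: "continuous_on (cball 0 1) u"
    unfolding u_def vector_scalar_mult_def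
    by (intro continuous_on_vec_lambda continuous_on_mult \<rho> \<gamma>)
  have w_u: "w z = hpoint (u z)" if "z \<in> cball 0 1" for z
    unfolding u_def using nz[OF that] \<rho>(2) that by (simp add: hpoint_smult)
  have norm_u: "norm (u z) = 1" if "z \<in> cball 0 1" for z
  proof -
    have "u z = (1 / norm (\<gamma> z)) *\<^sub>R \<gamma> z"
      unfolding vec_eq_iff vector_scaleR_component by (simp add: u_def \<rho>_def scaleR_conv_of_real)
    then show ?thesis
      using nz(1)[OF that] by simp
  qed
  obtain V where V: "continuous_on (cball 0 1) V" and frame: "\<And>z. z \<in> cball 0 1 \<Longrightarrow> tangent_frame (V z) (u z)"
    using tangent_frame_exists[OF cont_u norm_u] by metis
  have torus_w: "w z \<in> clifford_torus" if "z \<in> sphere 0 1" for z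
    using w that unfolding holomorphic_disc_def by blast
  have cl_frame: "clifford_tangent_frame (V z) (u z)" if z: "z \<in> sphere 0 1" for z
  proof -
    have z': "z \<in> cball 0 1"
      using z by simp
    have "hpoint (u z) \<in> clifford_torus" "u z \<noteq> 0"
      using torus_w[OF z] w_u[OF z'] norm_u[OF z'] by auto
    then have "\<forall>i j. norm (u z $ i) = norm (u z $ j)"
      using hpoint_in_clifford_torus by blast
    then show ?thesis
      using frame[OF z'] by (simp add: clifford_tangent_frame_def clifford_tangent_frame_axioms_def)
  qed
  have \<gamma>_nz: "\<forall>z\<in>sphere 0 1. \<gamma> z $ i \<noteq> 0" for i
  proof
    fix z :: complex assume z: "z \<in> sphere 0 1"
    then have "hpoint (\<gamma> z) \<in> clifford_torus" "\<gamma> z \<noteq> 0"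
      using torus_w[OF z] nz[of z] by auto
    then show "\<gamma> z $ i \<noteq> 0"
      using hpoint_in_clifford_torus clifford_torus_coord_nonzero by blast
  qed
  have wind_u: "winding_number ((\<lambda>z. u z $ i) \<circ> circlepath 0 1) 0 = of_nat (total_multiplicity w i)" for i
  proof -
    have "winding_number ((\<lambda>z. \<rho> z * \<gamma> z $ i) \<circ> circlepath 0 1) 0 =
        winding_number (\<rho> \<circ> circlepath 0 1) 0 + winding_number ((\<lambda>z. \<gamma> z $ i) \<circ> circlepath 0 1) 0"
      by (rule winding_number_circle_mult)
         (use \<rho> \<gamma>_nz in \<open>auto intro: continuous_on_subset[OF \<rho>(1)] continuous_on_subset[OF \<gamma>(1)]\<close>)
    moreover have "winding_number (\<rho> \<circ> circlepath 0 1) 0 = 0"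
      by (rule winding_number_circle_nonvanishing_on_disc[OF \<rho>])
    moreover have "winding_number ((\<lambda>z. \<gamma> z $ i) \<circ> circlepath 0 1) 0 = of_int (int (total_multiplicity w i))"
      unfolding total_multiplicity_eq_sum_zorder[OF w lift] of_int_sum
      by (rule winding_number_circle_eq_sum_zorder[OF \<gamma> \<gamma>_nz])
    ultimately show ?thesis
      by (simp add: u_def)
  qed
  define p where "p z = (\<Prod>i\<in>UNIV. u z $ i)" for z
  have u_nz: "u z $ i \<noteq> 0" if "z \<in> sphere 0 1" for z i
    using \<gamma>_nz \<rho>(2) that by (simp add: u_def)
  have u_comp: "continuous_on (sphere 0 1) (\<lambda>z. u z $ i)" for i
    by (rule continuous_on_subset[OF continuous_on_component[OF cont_u]]) auto
  have p: "continuous_on (sphere 0 1) p" "\<forall>z\<in>sphere 0 1. p z \<noteq> 0"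
    unfolding p_def using u_nz by (auto intro!: continuous_on_prod u_comp simp: prod_zero_iff)
  have wind_p: "winding_number (p \<circ> circlepath 0 1) 0 = of_nat (\<Sum>i\<in>UNIV. total_multiplicity w i)"
    unfolding p_def using winding_number_circle_prod[of UNIV "\<lambda>i z. u z $ i"] u_comp u_nz wind_u by simp
  \<comment> \<open>Proved for every admissible pair, this serves both halves of \<open>THE\<close>:
    the value is attained, and no other value is.\<close>
  have winding: "winding_number ((\<lambda>z. det (A z ** transpose (A z))) \<circ> circlepath 0 1) 0 =
      of_int (2 * int (\<Sum>i\<in>UNIV. total_multiplicity w i))"
    if \<Phi>: "hermitian_trivialization w \<Phi>"
      and A: "\<forall>z\<in>sphere 0 1. unitary_matrix (A z) \<and>
        \<Phi> z ` tangent_space_of clifford_torus (w z) = (\<lambda>v. A z *v v) ` real_vectors" for \<Phi> A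
  proof -
    obtain Q where Q: "continuous_on (cball 0 1) Q" "\<And>z. z \<in> cball 0 1 \<Longrightarrow> unitary_matrix (Q z)"
      "\<And>z X. z \<in> cball 0 1 \<Longrightarrow> X \<in> tangent_space (w z) \<Longrightarrow> \<Phi> z X = Q z *v frame_coords (V z) (u z) X"
      by (rule hermitian_trivialization_transition[OF V cont_u frame w_u \<Phi>]) (assumption+, rule that)
    define r where "r = det (barycenter_rotation :: complex ^ ('n option) ^ ('n option))"
    \<comment> \<open>The constant factors of \<open>det_clifford_frame\<close>, of which only the
      product being nonzero matters. Below, \<open>k\<close> collects everything that extends over
      the disc.\<close>
    define c where "c = \<i> ^ CARD('n) * (of_real (sqrt (CARD('n option))) ^ CARD('n option) * r)"
    define k where "k z = (c * (det (Q z) * cnj (det (V z))))\<^sup>2" for z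
    have "c \<noteq> 0"
      using det_unitary_matrix_nonzero[OF barycenter_rotation(1)] by (simp add: c_def r_def)
    have k: "continuous_on (cball 0 1) k" "\<forall>z\<in>cball 0 1. k z \<noteq> 0"
    proof -
      show "continuous_on (cball 0 1) k"
        unfolding k_def
        by (intro continuous_on_power continuous_on_mult continuous_on_const continuous_on_cnj continuous_on_det V Q)
      show "\<forall>z\<in>cball 0 1. k z \<noteq> 0"
        using \<open>c \<noteq> 0\<close> det_unitary_matrix_nonzero[OF Q(2)]
          det_unitary_matrix_nonzero[OF tangent_frame.unitary[OF frame]] by (simp add: k_def)
    qed
    have "det (A z ** transpose (A z)) = k z * (p z * p z)" if z: "z \<in> sphere 0 1" for z
    proof -
      have z': "z \<in> cball 0 1"
        using z by simp
      have "det (A z ** transpose (A z)) = (det (Q z) * det (clifford_frame (V z) (u z)))\<^sup>2"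
        by (rule det_mult_transpose_clifford[OF cl_frame[OF z] Q(2)[OF z'], of "\<Phi> z"])
           (use Q(3)[OF z'] A[rule_format, OF z] in \<open>simp_all add: w_u[OF z']\<close>)
      also have "\<dots> = k z * (p z * p z)"
        unfolding clifford_tangent_frame.det_clifford_frame[OF cl_frame[OF z]] k_def c_def r_def p_def
        by (simp add: power2_eq_square mult_ac)
      finally show ?thesis .
    qed
    then have "winding_number ((\<lambda>z. det (A z ** transpose (A z))) \<circ> circlepath 0 1) 0 =
        winding_number ((\<lambda>z. k z * (p z * p z)) \<circ> circlepath 0 1) 0"
      by (rule winding_number_circle_cong)
    also have "\<dots> = winding_number (k \<circ> circlepath 0 1) 0 + winding_number ((\<lambda>z. p z * p z) \<circ> circlepath 0 1) 0"
      by (rule winding_number_circle_mult)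
         (use k p in \<open>auto intro: continuous_on_subset[OF k(1)] continuous_on_mult\<close>)
    \<comment> \<open>Here \<open>k\<close> contributes degree 0 and \<open>p\<close> enters
      twice.\<close>
    also have "\<dots> = 2 * winding_number (p \<circ> circlepath 0 1) 0"
      using winding_number_circle_mult[OF p p] winding_number_circle_nonvanishing_on_disc[OF k] by simp
    finally show ?thesis
      by (simp add: wind_p)
  qed
  \<comment> \<open>One admissible pair must be exhibited, so that the index is attained at all: the
    frame coordinates together with \<open>clifford_frame\<close>.\<close>
  have triv: "hermitian_trivialization w (\<lambda>z. frame_coords (V z) (u z))"
    by (rule hermitian_trivialization_frame_coords[OF V cont_u frame w_u])
  have torus: "\<forall>z\<in>sphere 0 1. unitary_matrix (clifford_frame (V z) (u z)) \<and>
      frame_coords (V z) (u z) ` tangent_space_of clifford_torus (w z) =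
        (\<lambda>v. clifford_frame (V z) (u z) *v v) ` real_vectors"
    using clifford_tangent_frame.unitary_clifford_frame[OF cl_frame]
      clifford_tangent_frame.frame_coords_clifford_torus[OF cl_frame] w_u by simp
  show ?thesis
    unfolding maslov_index_def
  proof (rule the_equality)
    show "\<exists>\<Phi> A. hermitian_trivialization w \<Phi> \<and>
      (\<forall>z\<in>sphere 0 1. unitary_matrix (A z) \<and>
        \<Phi> z ` tangent_space_of clifford_torus (w z) = (\<lambda>v. A z *v v) ` real_vectors) \<and>
      winding_number ((\<lambda>z. det (A z ** transpose (A z))) \<circ> circlepath 0 1) 0 =
        of_int (2 * int (\<Sum>i\<in>UNIV. total_multiplicity w i))"
      by (rule exI[of _ "\<lambda>z. frame_coords (V z) (u z)"], rule exI[of _ "\<lambda>z. clifford_frame (V z) (u z)"],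
          intro conjI triv torus winding[OF triv torus])
    fix \<mu>
    assume "\<exists>\<Phi> A. hermitian_trivialization w \<Phi> \<and>
      (\<forall>z\<in>sphere 0 1. unitary_matrix (A z) \<and>
        \<Phi> z ` tangent_space_of clifford_torus (w z) = (\<lambda>v. A z *v v) ` real_vectors) \<and>
      winding_number ((\<lambda>z. det (A z ** transpose (A z))) \<circ> circlepath 0 1) 0 = of_int \<mu>"
    then obtain \<Phi> A where \<Phi>: "hermitian_trivialization w \<Phi>"
      and A: "\<forall>z\<in>sphere 0 1. unitary_matrix (A z) \<and>
        \<Phi> z ` tangent_space_of clifford_torus (w z) = (\<lambda>v. A z *v v) ` real_vectors"
      and \<mu>: "winding_number ((\<lambda>z. det (A z ** transpose (A z))) \<circ> circlepath 0 1) 0 = of_int \<mu>"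
      by (elim exE conjE)
    have "of_int \<mu> = (of_int (2 * int (\<Sum>i\<in>UNIV. total_multiplicity w i)) :: complex)"
      using winding[OF \<Phi> A] unfolding \<mu> .
    then show "\<mu> = 2 * int (\<Sum>i\<in>UNIV. total_multiplicity w i)"
      by (simp only: of_int_eq_iff)
  qed
qed

end
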